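(* Let $\mathfrak g=D(2,1;a)$ with $a\in\mathbb{Q}$, $-1<a<0$, and the data below. Let $\Lambda\in\hat{\mathfrak h}^*$ and $m_i=(\Lambda|\alpha_i)$ for $i=0,1,2,3$, so that the level is $k=\sum_{i=0}^3m_i$; assume $k\neq0$. Then: (a) $L(\Lambda)$ is integrable if and only if (i) $\frac{m_1+m_2}{a}$, $\frac{m_0+m_3}{a}$, $-\frac{m_1+m_3}{a+1}$, $-\frac{m_0+m_2}{a+1}$ are non-negative integers, and (ii) $m_i+m_j=0\Rightarrow m_i=m_j=0$ for $i\in\{0,1\}$, $j\in\{2,3\}$. (b) $L(\Lambda)$ is $(\alpha_0+\alpha_1)$-integrable (resp. $(\alpha_2+\alpha_3)$-integrable) if and only if (i) $m_0+m_1\in\mathbb{Z}_{\ge0}$ (resp. $m_2+m_3\in\mathbb{Z}_{\ge0}$), and (ii) $m_0+m_1=0\Rightarrow m_0=m_1=0$ (resp. $m_2+m_3=0\Rightarrow m_2=m_3=0$).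
   Context: $D(2,1;a)$ is the 17-dimensional simple basic Lie superalgebra with even part $\mathfrak{sl}(2)^{\oplus3}$, with nondegenerate invariant supersymmetric form $(\cdot|\cdot)$ and Cartan subalgebra $\mathfrak h$ identified with $\mathfrak h^*$. Affine: $\hat{\mathfrak g}=\mathfrak g[t,t^{-1}]\oplus\mathbb{C}K\oplus\mathbb{C}d$, $[at^r,bt^s]=[a,b]t^{r+s}+r\delta_{r,-s}(a|b)K$, $K$ central, $[d,at^r]=rat^r$; $\hat{\mathfrak h}=\mathfrak h\oplus\mathbb{C}K\oplus\mathbb{C}d$ with form extended by $(\mathfrak h|\mathbb{C}K+\mathbb{C}d)=0$, $(K|K)=(d|d)=0$, $(K|d)=1$; $\delta$ corresponds to $K$. Simple roots of $\mathfrak g$: odd isotropic $\alpha_1,\alpha_2,\alpha_3$ with $(\alpha_1|\alpha_2)=a$, $(\alpha_1|\alpha_3)=-(a+1)$, $(\alpha_2|\alpha_3)=1$; highest root $\theta=\alpha_1+\alpha_2+\alpha_3$; $\alpha_0=\delta-\theta$; positive roots of $\hat{\mathfrak g}$ are the positive roots of $\mathfrak g$ and $\alpha+r\delta$ ($\alpha$ a root or 0, $r>0$). $L(\Lambda)$ is the irreducible highest weight module of highest weight $\Lambda$. For a positive root $\gamma$, $L(\Lambda)$ is $\gamma$-integrable if $\hat{\mathfrak g}_{-\gamma}$ acts locally nilpotently. $\mathfrak g^\#_{\bar0}\cong\mathfrak{sl}(2)\oplus\mathfrak{sl}(2)$ is the subalgebra with simple roots $\alpha_1+\alpha_2$, $\alpha_1+\alpha_3$,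 root set $\Delta^\#_{\bar0}$; $L(\Lambda)$ is integrable if it is $\gamma$-integrable for all positive $\gamma\in\Delta^\#_{\bar0}$ and all $\alpha+r\delta$ with $\alpha\in\Delta^\#_{\bar0}$, $r\in\mathbb{Z}_{>0}$. *)

theory Defs
  imports Complex_Main
begin

text \<open>Explicit model of D(2,1;a) (Scheunert's realisation) and of its affinisation.

  Even part: three copies of sl(2), basis gE i, gH i, gF i (i = I1, I2, I3).
  Odd part: C^2 (x) C^2 (x) C^2, basis gO s1 s2 s3 (True = +, False = -),
  the vector v_{s1} (x) v_{s2} (x) v_{s3}.
  Cartan subalgebra h = span of gH I1, gH I2, gH I3; eps_j in h* is dual to gH j.
  The simple roots are alpha1 = -eps1+eps2+eps3, alpha2 = eps1-eps2+eps3,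
  alpha3 = eps1+eps2-eps3 (all odd, isotropic), theta = eps1+eps2+eps3.
  The invariant form is normalised so that (eps_j|eps_j) = bco a j with
  bco = (1/2, -(a+1)/2, a/2); this gives (alpha1|alpha2) = a,
  (alpha1|alpha3) = -(a+1), (alpha2|alpha3) = 1.\<close>

datatype idx = I1 | I2 | I3

datatype gbasis = gE idx | gH idx | gF idx | gO bool bool bool

text \<open>basis of the affine algebra: x t^n, K, d\<close>
datatype abasis = Tt gbasis int | Kc | Dc

text \<open>basis of hat h = h + C K + C d; elements of hat h^* are functions hhat => complex\<close>
datatype hhat = hH idx | hK | hD

definition dl :: "'a \<Rightarrow> 'a \<Rightarrow> complex" where
  "dl x y = (if x = y then 1 else 0)"

definition sg :: "bool \<Rightarrow> complex" where
  "sg b = (if b then 1 else -1)"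

definition mkO :: "(idx \<Rightarrow> bool) \<Rightarrow> gbasis" where
  "mkO s = gO (s I1) (s I2) (s I3)"

definition osv :: "bool \<Rightarrow> bool \<Rightarrow> bool \<Rightarrow> idx \<Rightarrow> bool" where
  "osv s1 s2 s3 i = (case i of I1 \<Rightarrow> s1 | I2 \<Rightarrow> s2 | I3 \<Rightarrow> s3)"

text \<open>(eps_i|eps_i); also the structure constants sigma_i of the odd bracket\<close>
definition bco :: "real \<Rightarrow> idx \<Rightarrow> complex" where
  "bco a i = (case i of I1 \<Rightarrow> 1/2 | I2 \<Rightarrow> - (of_real a + 1) / 2 | I3 \<Rightarrow> of_real a / 2)"

text \<open>(gH i | gH i) = 1 / (eps_i|eps_i)\<close>
definition cco :: "real \<Rightarrow> idx \<Rightarrow> complex" where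
  "cco a i = 1 / bco a i"

text \<open>coefficient of Z in [X, v_s] for X even\<close>
fun act :: "gbasis \<Rightarrow> (idx \<Rightarrow> bool) \<Rightarrow> gbasis \<Rightarrow> complex" where
  "act (gH i) s Z = sg (s i) * dl Z (mkO s)"
| "act (gE i) s Z = (if s i then 0 else dl Z (mkO (s(i := True))))"
| "act (gF i) s Z = (if s i then dl Z (mkO (s(i := False))) else 0)"
| "act (gO _ _ _) s Z = 0"

text \<open>symplectic form on C^2 and the map p : C^2 x C^2 -> sl(2)\<close>
definition psi :: "bool \<Rightarrow> bool \<Rightarrow> complex" where
  "psi s t = (if s \<and> \<not> t then 1 else if \<not> s \<and> t then -1 else 0)"

definition pp :: "idx \<Rightarrow> bool \<Rightarrow> bool \<Rightarrow> gbasis \<Rightarrow> complex" where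
  "pp i s t Z = (if s \<and> t then 2 * dl Z (gE i)
                 else if \<not> s \<and> \<not> t then -2 * dl Z (gF i) else - dl Z (gH i))"

definition oddbr :: "real \<Rightarrow> bool \<Rightarrow> bool \<Rightarrow> bool \<Rightarrow> bool \<Rightarrow> bool \<Rightarrow> bool \<Rightarrow> gbasis \<Rightarrow> complex" where
  "oddbr a s1 s2 s3 t1 t2 t3 Z =
     bco a I1 * psi s2 t2 * psi s3 t3 * pp I1 s1 t1 Z
   + bco a I2 * psi s1 t1 * psi s3 t3 * pp I2 s2 t2 Z
   + bco a I3 * psi s1 t1 * psi s2 t2 * pp I3 s3 t3 Z"

text \<open>gbr a X Y Z = coefficient of Z in the super bracket [X, Y] of D(2,1;a)\<close>
fun gbr :: "real \<Rightarrow> gbasis \<Rightarrow> gbasis \<Rightarrow> gbasis \<Rightarrow> complex" where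
  "gbr a (gO s1 s2 s3) (gO t1 t2 t3) Z = oddbr a s1 s2 s3 t1 t2 t3 Z"
| "gbr a (gO s1 s2 s3) Y Z = - act Y (osv s1 s2 s3) Z"
| "gbr a X (gO t1 t2 t3) Z = act X (osv t1 t2 t3) Z"
| "gbr a (gE i) (gF j) Z = (if i = j then dl Z (gH i) else 0)"
| "gbr a (gF i) (gE j) Z = (if i = j then - dl Z (gH i) else 0)"
| "gbr a (gH i) (gE j) Z = (if i = j then 2 * dl Z (gE i) else 0)"
| "gbr a (gE i) (gH j) Z = (if i = j then -2 * dl Z (gE i) else 0)"
| "gbr a (gH i) (gF j) Z = (if i = j then -2 * dl Z (gF i) else 0)"
| "gbr a (gF i) (gH j) Z = (if i = j then 2 * dl Z (gF i) else 0)"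
| "gbr a X Y Z = 0"

fun gform :: "real \<Rightarrow> gbasis \<Rightarrow> gbasis \<Rightarrow> complex" where
  "gform a (gO s1 s2 s3) (gO t1 t2 t3) = - (psi s1 t1 * psi s2 t2 * psi s3 t3)"
| "gform a (gE i) (gF j) = (if i = j then cco a i / 2 else 0)"
| "gform a (gF i) (gE j) = (if i = j then cco a i / 2 else 0)"
| "gform a (gH i) (gH j) = (if i = j then cco a i else 0)"
| "gform a X Y = 0"

definition godd :: "gbasis \<Rightarrow> bool" where
  "godd X = (case X of gO _ _ _ \<Rightarrow> True | _ \<Rightarrow> False)"

definition gall :: "gbasis list" where
  "gall = [gE I1, gE I2, gE I3, gH I1, gH I2, gH I3, gF I1, gF I2, gF I3,
           gO True True True, gO True True False, gO True False True, gO True False False,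
           gO False True True, gO False True False, gO False False True, gO False False False]"

definition gpos :: "gbasis \<Rightarrow> bool" where
  "gpos X = (X \<in> {gE I1, gE I2, gE I3, gO True True True, gO False True True,
                  gO True False True, gO True True False})"

definition gwt :: "gbasis \<Rightarrow> idx \<Rightarrow> complex" where
  "gwt X j = (case X of gE i \<Rightarrow> 2 * dl i j | gH i \<Rightarrow> 0 | gF i \<Rightarrow> -2 * dl i j
                       | gO s1 s2 s3 \<Rightarrow> sg (osv s1 s2 s3 j))"

definition awt :: "gbasis \<Rightarrow> int \<Rightarrow> hhat \<Rightarrow> complex" where
  "awt X n h = (case h of hH j \<Rightarrow> gwt X j | hK \<Rightarrow> 0 | hD \<Rightarrow> of_int n)"

text \<open>the form on hat h^* induced by the form on hat h
  ((gH i|gH j) = cco a i * [i=j], (K|d) = 1, (K|K) = (d|d) = 0, h orthogonal to K, d)\<close>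
definition hform :: "real \<Rightarrow> (hhat \<Rightarrow> complex) \<Rightarrow> (hhat \<Rightarrow> complex) \<Rightarrow> complex" where
  "hform a l m = bco a I1 * l (hH I1) * m (hH I1) + bco a I2 * l (hH I2) * m (hH I2)
                + bco a I3 * l (hH I3) * m (hH I3) + l hK * m hD + l hD * m hK"

definition deltaw :: "hhat \<Rightarrow> complex" where
  "deltaw h = (case h of hD \<Rightarrow> 1 | _ \<Rightarrow> 0)"

definition epsw :: "idx \<Rightarrow> hhat \<Rightarrow> complex" where
  "epsw i h = (case h of hH j \<Rightarrow> dl i j | _ \<Rightarrow> 0)"

definition alpha :: "nat \<Rightarrow> hhat \<Rightarrow> complex" where
  "alpha i h = (if i = 1 then - epsw I1 h + epsw I2 h + epsw I3 h
                else if i = 2 then epsw I1 h - epsw I2 h + epsw I3 h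
                else if i = 3 then epsw I1 h + epsw I2 h - epsw I3 h
                else deltaw h - (epsw I1 h + epsw I2 h + epsw I3 h))"

definition wadd :: "(hhat \<Rightarrow> complex) \<Rightarrow> (hhat \<Rightarrow> complex) \<Rightarrow> hhat \<Rightarrow> complex" where
  "wadd l m h = l h + m h"

text \<open>the root set Delta^#_0 of g^#_0 (sl2 + sl2 with simple roots alpha1+alpha2, alpha1+alpha3)\<close>
definition rootsharp :: "(hhat \<Rightarrow> complex) set" where
  "rootsharp = {wadd (alpha 1) (alpha 2), wadd (alpha 1) (alpha 3),
                (\<lambda>h. - wadd (alpha 1) (alpha 2) h), (\<lambda>h. - wadd (alpha 1) (alpha 3) h)}"

definition posrootsharp :: "(hhat \<Rightarrow> complex) set" where
  "posrootsharp = {wadd (alpha 1) (alpha 2), wadd (alpha 1) (alpha 3)}"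

text \<open>L(Lambda) realised on the whole type 'v (complex vector space via scale):
  rho gives the action of the basis elements of hat g; the super commutation relations
  of hat g hold; v0 is a nonzero highest weight vector of weight Lam; the module is irreducible.
  (An irreducible module with a highest weight vector of weight Lam is L(Lam).)\<close>
definition is_L :: "real \<Rightarrow> (complex \<Rightarrow> 'v::ab_group_add \<Rightarrow> 'v) \<Rightarrow> (abasis \<Rightarrow> 'v \<Rightarrow> 'v)
                     \<Rightarrow> (hhat \<Rightarrow> complex) \<Rightarrow> 'v \<Rightarrow> bool" where
  "is_L a scale rho Lam v0 \<longleftrightarrow>
     Vector_Spaces.vector_space scale
   \<and> (\<forall>b. Vector_Spaces.linear scale scale (rho b))
   \<and> (\<forall>X Y m n w.
        rho (Tt X m) (rho (Tt Y n) w)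
          - scale (if godd X \<and> godd Y then -1 else 1) (rho (Tt Y n) (rho (Tt X m) w))
        = sum_list (map (\<lambda>Z. scale (gbr a X Y Z) (rho (Tt Z (m + n)) w)) gall)
          + scale (of_int m * (if m + n = 0 then gform a X Y else 0)) (rho Kc w))
   \<and> (\<forall>b w. rho Kc (rho b w) = rho b (rho Kc w))
   \<and> (\<forall>X n w. rho Dc (rho (Tt X n) w) - rho (Tt X n) (rho Dc w) = scale (of_int n) (rho (Tt X n) w))
   \<and> v0 \<noteq> 0
   \<and> (\<forall>i. rho (Tt (gH i) 0) v0 = scale (Lam (hH i)) v0)
   \<and> rho Kc v0 = scale (Lam hK) v0
   \<and> rho Dc v0 = scale (Lam hD) v0
   \<and> (\<forall>X. gpos X \<longrightarrow> rho (Tt X 0) v0 = 0)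
   \<and> (\<forall>X n. n > 0 \<longrightarrow> rho (Tt X n) v0 = 0)
   \<and> (\<forall>U. module.subspace scale U \<and> (\<forall>b. \<forall>u\<in>U. rho b u \<in> U) \<longrightarrow> U = {0} \<or> U = UNIV)"

definition locnil :: "('v::zero \<Rightarrow> 'v) \<Rightarrow> bool" where
  "locnil f \<longleftrightarrow> (\<forall>w. \<exists>N. (f ^^ N) w = 0)"

text \<open>gamma-integrable: every element of the root space hat g_{-gamma} (gamma a nonzero
  weight) acts locally nilpotently.  Elements of hat g_{-gamma} are the linear combinations of
  basis vectors X t^n of weight -gamma.\<close>
definition root_integrable :: "(complex \<Rightarrow> 'v::ab_group_add \<Rightarrow> 'v) \<Rightarrow> (abasis \<Rightarrow> 'v \<Rightarrow> 'v)
                                 \<Rightarrow> (hhat \<Rightarrow> complex) \<Rightarrow> bool" where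
  "root_integrable scale rho \<gamma> \<longleftrightarrow>
     (\<forall>n cf. (\<forall>X. cf X \<noteq> 0 \<longrightarrow> awt X n = (\<lambda>h. - \<gamma> h))
        \<longrightarrow> locnil (\<lambda>w. sum_list (map (\<lambda>X. scale (cf X) (rho (Tt X n) w)) gall)))"

definition integrable :: "(complex \<Rightarrow> 'v::ab_group_add \<Rightarrow> 'v) \<Rightarrow> (abasis \<Rightarrow> 'v \<Rightarrow> 'v) \<Rightarrow> bool" where
  "integrable scale rho \<longleftrightarrow>
     (\<forall>\<gamma>\<in>posrootsharp. root_integrable scale rho \<gamma>)
   \<and> (\<forall>\<alpha>\<in>rootsharp. \<forall>r::nat. r > 0 \<longrightarrow>
        root_integrable scale rho (\<lambda>h. \<alpha> h + of_nat r * deltaw h))"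

end

(* Odd reflections reduce integrability to sl(2). For nodes i, j put f_ij = [f_i, f_j], a root vector
   for the even real root alpha_i + alpha_j. If m_i <> 0, then v1 = f_i v0 is nonzero and is killed by
   e_ij, f_i and all e_k with k <> i; its weight on the coroot of alpha_i + alpha_j is n - 1, where n is
   the value of Lambda. If n - 1 is a natural number, u = f_ij^n v1 is killed by e_k and e_ik for k <> i,
   so first e_i u and then u itself is singular of lower height and vanishes by irreducibility; sl(2)
   theory gives the converse. If m_i = m_j = 0, then f_i v0 and f_j v0 are singular, hence f_ij v0 = 0.
   Vectors on which a real root vector is nilpotent form a submodule, so one nonzero such vector suffices.
   The simple roots of the affine sl(2)'s generate all real roots through reflections. *)
theory Submission
  imports Defs
begin

text \<open>The four affine simple roots are isotropic and pairwise non-orthogonal, so one argument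
  serves all six pairs. The obstacle is that \<alpha>_i + \<alpha>_j is not simple: [e_i, f_ij] is a
  multiple of f_j and [e_j, f_ij] one of f_i, so a power of f_ij applied to v0 need not become
  singular. The base reflected at \<alpha>_i consists of -\<alpha>_i and all \<alpha>_i + \<alpha>_k
  with k \<noteq> i; there \<alpha>_i + \<alpha>_j is simple. No decomposition into weight spaces is
  set up, so two standard arguments take another form: that a singular vector of lower height cannot
  generate v0 is seen from polynomials in a grading operator, and exponentials of root vectors are
  replaced by an identity for high powers on a kernel. The denominators a and -(a+1) are values of
  (\<alpha>_i | \<alpha>_j).\<close>

datatype node = N0 | N1 | N2 | N3

text \<open>The node \<open>Ni\<close> stands for \<open>\<alpha>\<^sub>i\<close>; the Chevalley generators are normalised so that
  \<open>[e\<^sub>i, f\<^sub>i]\<close> is the element of the Cartan subalgebra identified with \<open>\<alpha>\<^sub>i\<close> by the form.\<close>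

fun e_gen :: "node \<Rightarrow> abasis" where
  "e_gen N0 = Tt (gO False False False) 1"
| "e_gen N1 = Tt (gO False True True) 0"
| "e_gen N2 = Tt (gO True False True) 0"
| "e_gen N3 = Tt (gO True True False) 0"

fun f_gen :: "node \<Rightarrow> abasis" where
  "f_gen N0 = Tt (gO True True True) (-1)"
| "f_gen N1 = Tt (gO True False False) 0"
| "f_gen N2 = Tt (gO False True False) 0"
| "f_gen N3 = Tt (gO False False True) 0"

text \<open>Modulo \<open>\<delta>\<close>, the sum \<open>\<alpha>\<^sub>i + \<alpha>\<^sub>j\<close> is \<open>\<plusminus>2\<epsilon>\<^sub>k\<close> with \<open>k = pair_idx i j\<close>; the values on the diagonal are junk.\<close>

fun pair_idx :: "node \<Rightarrow> node \<Rightarrow> idx" where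
  "pair_idx N0 N1 = I1" | "pair_idx N1 N0 = I1" | "pair_idx N2 N3 = I1" | "pair_idx N3 N2 = I1"
| "pair_idx N0 N2 = I2" | "pair_idx N2 N0 = I2" | "pair_idx N1 N3 = I2" | "pair_idx N3 N1 = I2"
| "pair_idx _ _ = I3"

text \<open>\<alpha>_0 + \<alpha>_j is \<delta> - 2\<epsilon>_k while the other sums are
  +2\<epsilon>_k, so with \<open>N0\<close> the raising vector is \<open>gF\<close> times t.\<close>

definition e_pair :: "node \<Rightarrow> node \<Rightarrow> abasis" where
  "e_pair i j = (if i = N0 \<or> j = N0 then Tt (gF (pair_idx i j)) 1 else Tt (gE (pair_idx i j)) 0)"

definition f_pair :: "node \<Rightarrow> node \<Rightarrow> abasis" where
  "f_pair i j = (if i = N0 \<or> j = N0 then Tt (gE (pair_idx i j)) (-1) else Tt (gF (pair_idx i j)) 0)"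

fun node_no :: "node \<Rightarrow> nat" where
  "node_no N0 = 0" | "node_no N1 = 1" | "node_no N2 = 2" | "node_no N3 = 3"

definition nilvec :: "('v::zero \<Rightarrow> 'v) \<Rightarrow> 'v set" where
  "nilvec z = {x. \<exists>N. (z ^^ N) x = 0}"

section \<open>Commutation relations and weight vectors\<close>

lemma sum_list_gall_delta: "sum_list (map (\<lambda>X. if X = Z then g X else (0::'v::ab_group_add)) gall) = g Z"
proof (cases Z)
  case (gE k) then show ?thesis by (cases k) (simp_all add: gall_def)
next
  case (gF k) then show ?thesis by (cases k) (simp_all add: gall_def)
next
  case (gH k) then show ?thesis by (cases k) (simp_all add: gall_def)
next
  case (gO s t u) then show ?thesis by (cases s; cases t; cases u) (simp_all add: gall_def)
qed

lemma is_L_D: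
  assumes "is_L a scale rho Lam v0"
  shows "\<forall>b. Vector_Spaces.linear scale scale (rho b)"
    and "\<forall>X Y m n w.
        rho (Tt X m) (rho (Tt Y n) w)
          - scale (if godd X \<and> godd Y then -1 else 1) (rho (Tt Y n) (rho (Tt X m) w))
        = sum_list (map (\<lambda>Z. scale (gbr a X Y Z) (rho (Tt Z (m + n)) w)) gall)
          + scale (of_int m * (if m + n = 0 then gform a X Y else 0)) (rho Kc w)"
    and "\<forall>b w. rho Kc (rho b w) = rho b (rho Kc w)"
    and "\<forall>X n w. rho Dc (rho (Tt X n) w) - rho (Tt X n) (rho Dc w) = scale (of_int n) (rho (Tt X n) w)"
    and "v0 \<noteq> 0"
    and "\<forall>i. rho (Tt (gH i) 0) v0 = scale (Lam (hH i)) v0"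
    and "rho Kc v0 = scale (Lam hK) v0"
    and "rho Dc v0 = scale (Lam hD) v0"
    and "\<forall>X. gpos X \<longrightarrow> rho (Tt X 0) v0 = 0"
    and "\<forall>X n. n > 0 \<longrightarrow> rho (Tt X n) v0 = 0"
    and "\<forall>U. module.subspace scale U \<and> (\<forall>b. \<forall>u\<in>U. rho b u \<in> U) \<longrightarrow> U = {0} \<or> U = UNIV"
  by (insert assms, unfold is_L_def, elim conjE, assumption)+

locale L_module = vector_space scale
  for scale :: "complex \<Rightarrow> 'v::ab_group_add \<Rightarrow> 'v" +
  fixes a :: real and rho :: "abasis \<Rightarrow> 'v \<Rightarrow> 'v" and Lam :: "hhat \<Rightarrow> complex" and v0 :: 'v
  assumes isL: "is_L a scale rho Lam v0" and a_gt: "-1 < a" and a_lt: "a < 0"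
begin

lemma rho_linear: "Vector_Spaces.linear scale scale (rho b)"
  using is_L_D(1)[OF isL] by blast

lemmas rho_add [simp] = module_hom.add[OF module_hom_iff_linear[THEN iffD2, OF rho_linear]]
  and rho_scale [simp] = module_hom.scale[OF module_hom_iff_linear[THEN iffD2, OF rho_linear]]
  and rho_zero [simp] = module_hom.zero[OF module_hom_iff_linear[THEN iffD2, OF rho_linear]]
  and rho_neg [simp] = module_hom.neg[OF module_hom_iff_linear[THEN iffD2, OF rho_linear]]
  and rho_diff [simp] = module_hom.diff[OF module_hom_iff_linear[THEN iffD2, OF rho_linear]]

lemma comm:
  "rho (Tt X m) (rho (Tt Y n) w)
     = scale (if godd X \<and> godd Y then -1 else 1) (rho (Tt Y n) (rho (Tt X m) w))
       + (sum_list (map (\<lambda>Z. scale (gbr a X Y Z) (rho (Tt Z (m + n)) w)) gall)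
          + scale (of_int m * (if m + n = 0 then gform a X Y else 0)) (rho Kc w))"
  using is_L_D(2)[OF isL, rule_format, of X m Y n w] unfolding diff_eq_eq by (subst add.commute)

text \<open>Most brackets of basis vectors needed below have a single term; \<open>c = 0\<close>
  covers the vanishing ones.\<close>

lemma comm1:
  assumes "\<And>Z. gbr a X Y Z = (if Z = Z0 then c else 0)"
  shows "rho (Tt X m) (rho (Tt Y n) w)
     = scale (if godd X \<and> godd Y then -1 else 1) (rho (Tt Y n) (rho (Tt X m) w))
       + (scale c (rho (Tt Z0 (m + n)) w)
          + scale (of_int m * (if m + n = 0 then gform a X Y else 0)) (rho Kc w))"
proof -
  have "(\<lambda>Z. scale (gbr a X Y Z) (rho (Tt Z (m + n)) w))
      = (\<lambda>Z. if Z = Z0 then scale c (rho (Tt Z (m + n)) w) else 0)"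
    by (auto simp: assms)
  then show ?thesis unfolding comm[of X m Y n w] by (simp add: sum_list_gall_delta)
qed

lemma K_comm: "rho Kc (rho b w) = rho b (rho Kc w)"
  using is_L_D(3)[OF isL] by blast

lemma D_comm: "rho Dc (rho (Tt X n) w) = rho (Tt X n) (rho Dc w) + scale (of_int n) (rho (Tt X n) w)"
  using is_L_D(4)[OF isL, rule_format, of X n w] unfolding diff_eq_eq by (subst add.commute)

lemma v0_nonzero: "v0 \<noteq> 0" by (rule is_L_D(5)[OF isL])

lemma e_v0: "rho (e_gen i) v0 = 0"
  using is_L_D(9,10)[OF isL] by (cases i) (simp_all add: gpos_def)

lemma irreducible:
  "subspace U \<Longrightarrow> (\<And>b u. u \<in> U \<Longrightarrow> rho b u \<in> U) \<Longrightarrow> U = {0} \<or> U = UNIV"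
  using is_L_D(11)[OF isL] by blast

text \<open>The zero vector has every weight, so weights pass through operators without a proof that
  the image is nonzero.\<close>

definition weight_vec :: "(hhat \<Rightarrow> complex) \<Rightarrow> 'v \<Rightarrow> bool" where
  "weight_vec \<mu> x \<longleftrightarrow> (\<forall>k. rho (Tt (gH k) 0) x = scale (\<mu> (hH k)) x)
     \<and> rho Kc x = scale (\<mu> hK) x \<and> rho Dc x = scale (\<mu> hD) x"

lemma weight_v0: "weight_vec Lam v0"
  using is_L_D(6-8)[OF isL] unfolding weight_vec_def by blast

lemma a_nonzero: "complex_of_real a \<noteq> 0" "1 + complex_of_real a \<noteq> 0" "complex_of_real a + 1 \<noteq> 0"
  "- complex_of_real a \<noteq> 1" "complex_of_real a \<noteq> -1" "-1 - complex_of_real a \<noteq> 0"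
proof -
  show "complex_of_real a \<noteq> 0" using a_lt by simp
  have "complex_of_real a \<noteq> complex_of_real (-1)" unfolding of_real_eq_iff using a_gt by simp
  then have *: "complex_of_real a \<noteq> -1" by simp
  then show "complex_of_real a \<noteq> -1" .
  show "1 + complex_of_real a \<noteq> 0" "complex_of_real a + 1 \<noteq> 0" "- complex_of_real a \<noteq> 1"
    "-1 - complex_of_real a \<noteq> 0"
    using * by algebra+
qed

lemma bco_nonzero: "bco a k \<noteq> 0"
  using a_nonzero by (cases k) (simp_all add: bco_def)

lemma H_gbr: "gbr a (gH k) Y Z = (if Z = Y then gwt Y k else 0)"
  by (cases Y) (auto simp: gwt_def dl_def mkO_def osv_def split: idx.splits)

lemma weight_rho: 
  assumes "weight_vec \<mu> x" shows "weight_vec (\<lambda>h. \<mu> h + awt X n h) (rho (Tt X n) x)"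
proof -
  have "rho (Tt (gH k) 0) (rho (Tt X n) x) = scale (\<mu> (hH k) + gwt X k) (rho (Tt X n) x)" for k
    using assms unfolding weight_vec_def comm1[OF H_gbr, of k 0 X n] 
    by (simp add: godd_def scale_left_distrib add.commute)
  then show ?thesis using assms
    by (simp add: weight_vec_def awt_def K_comm D_comm scale_left_distrib)
qed

section \<open>Generation of the affine algebra by the odd root vectors\<close>

text \<open>A bracket with one term can be solved for \<open>Z0\<close>. The hypothesis on degrees
  and form removes the central term, so invariance under \<open>Kc\<close> can be proved
  last.\<close>

lemma invariant_bracket:
  assumes U: "subspace U" and b: "\<And>Z. gbr a X Y Z = (if Z = Z0 then c else 0)" "c \<noteq> 0"
    and c: "m + n \<noteq> 0 \<or> gform a X Y = 0 \<or> m = 0"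
    and X: "\<And>u. u \<in> U \<Longrightarrow> rho (Tt X m) u \<in> U" and Y: "\<And>u. u \<in> U \<Longrightarrow> rho (Tt Y n) u \<in> U"
    and u: "u \<in> U"
  shows "rho (Tt Z0 (m + n)) u \<in> U"
proof -
  let ?s = "if godd X \<and> godd Y then -1 else 1 :: complex"
  have z: "of_int m * (if m + n = 0 then gform a X Y else 0) = 0" using c by auto
  have "scale c (rho (Tt Z0 (m + n)) u)
      = rho (Tt X m) (rho (Tt Y n) u) - scale ?s (rho (Tt Y n) (rho (Tt X m) u))"
    unfolding comm1[OF b(1), of m n u] z by simp
  also have "\<dots> \<in> U" using U X Y u by (intro subspace_diff subspace_scale) auto
  finally have "scale (inverse c) (scale c (rho (Tt Z0 (m + n)) u)) \<in> U"
    by (rule subspace_scale[OF U])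
  then show ?thesis using b(2) by simp
qed

text \<open>Brackets of two generators give the even root vectors of degree 0, these move one odd
  vector to all the others, and \<open>gH k\<close> in degrees 1 and -1 then shifts the degree.
  \<open>Dc\<close> is not a combination of brackets and is assumed separately.\<close>

lemma invariant_generated:
  assumes U: "subspace U" and e: "\<And>i u. u \<in> U \<Longrightarrow> rho (e_gen i) u \<in> U"
    and f: "\<And>i u. u \<in> U \<Longrightarrow> rho (f_gen i) u \<in> U" and D: "\<And>u. u \<in> U \<Longrightarrow> rho Dc u \<in> U"
    and u: "u \<in> U"
  shows "rho b u \<in> U"
proof -
  define J where "J b \<longleftrightarrow> (\<forall>u\<in>U. rho b u \<in> U)" for b
  have br: "J (Tt Z0 p)" if "J (Tt X m)" "J (Tt Y n)" "\<forall>Z. gbr a X Y Z = (if Z = Z0 then c else 0)" 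
    "c \<noteq> 0" "m + n \<noteq> 0 \<or> gform a X Y = 0 \<or> m = 0" "p = m + n" for X Y m n Z0 c p
    using invariant_bracket[OF U, of X Y Z0 c m n] that unfolding J_def by blast
  have e0: "J (e_gen i)" "J (f_gen i)" for i using e f by (auto simp: J_def)
  have a0: "a \<noteq> 0" using a_lt by simp
  note simps = a0 a_nonzero[THEN not_sym] oddbr_def psi_def pp_def bco_def dl_def a_nonzero mkO_def osv_def cco_def
  \<comment> \<open>The coefficients here and in \<open>F0\<close> are \<plusminus>2
    \<open>bco a k\<close>, nonzero because a is neither 0 nor -1.\<close>
  have E0: "J (Tt (gE k) 0)" for k
  proof (cases k)
    case I1 show ?thesis
      unfolding I1
      by (rule br[OF e0(1)[of N2, simplified] e0(1)[of N3, simplified], of "gE I1" "-1"]) (auto simp: simps field_simps)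
  next
    case I2 show ?thesis
      unfolding I2
      by (rule br[OF e0(1)[of N1, simplified] e0(1)[of N3, simplified], of "gE I2" "1 + of_real a"]) (auto simp: simps field_simps)
  next
    case I3 show ?thesis
      unfolding I3
      by (rule br[OF e0(1)[of N1, simplified] e0(1)[of N2, simplified], of "gE I3" "- of_real a"]) (auto simp: simps field_simps)
  qed
  have F0: "J (Tt (gF k) 0)" for k
  proof (cases k)
    case I1 show ?thesis
      unfolding I1
      by (rule br[OF e0(2)[of N2, simplified] e0(2)[of N3, simplified], of "gF I1" "1"]) (auto simp: simps field_simps)
  next
    case I2 show ?thesis
      unfolding I2
      by (rule br[OF e0(2)[of N1, simplified] e0(2)[of N3, simplified], of "gF I2" "- (1 + of_real a)"]) (auto simp: simps field_simps)
  next
    case I3 show ?thesis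
      unfolding I3
      by (rule br[OF e0(2)[of N1, simplified] e0(2)[of N2, simplified], of "gF I3" "of_real a"]) (auto simp: simps field_simps)
  qed
  have O0: "J (Tt (gO True True True) 0)" "J (Tt (gO False False False) 0)"
    using br[OF E0[of I1] e0(1)[of N1, simplified], of "gO True True True" 1]
      br[OF F0[of I1] e0(2)[of N1, simplified], of "gO False False False" 1]
    by (simp_all add: simps)
  have O: "J (Tt (gO s t w) 0)" for s t w
    using O0 e0(1)[of N1] e0(1)[of N2] e0(1)[of N3] e0(2)[of N1] e0(2)[of N2] e0(2)[of N3]
    by (cases s; cases t; cases w) simp_all
  \<comment> \<open>The factor \<open>gF k\<close> has degree 0, so no central term appears,
    whatever \<open>n\<close> is.\<close>
  have H: "J (Tt (gH k) n)" if "J (Tt (gE k) n)" for k n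
    by (rule br[OF F0[of k] that, of "gH k" "-1"]) (auto simp: simps)
  have up: "J (Tt (gO True t w) n)" if "J (Tt (gO False t w) n)" for t w n
    by (rule br[OF E0[of I1] that, of "gO True t w" 1]) (auto simp: simps)
  have up2: "J (Tt (gO t True w) n)" if "J (Tt (gO t False w) n)" for t w n
    by (rule br[OF E0[of I2] that, of "gO t True w" 1]) (auto simp: simps)
  have up3: "J (Tt (gO t w True) n)" if "J (Tt (gO t w False) n)" for t w n
    by (rule br[OF E0[of I3] that, of "gO t w True" 1]) (auto simp: simps)
  have dn: "J (Tt (gO False t w) n)" if "J (Tt (gO True t w) n)" for t w n
    by (rule br[OF F0[of I1] that, of "gO False t w" 1]) (auto simp: simps)
  have dn2: "J (Tt (gO t False w) n)" if "J (Tt (gO t True w) n)" for t w n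
    by (rule br[OF F0[of I2] that, of "gO t False w" 1]) (auto simp: simps)
  have dn3: "J (Tt (gO t w False) n)" if "J (Tt (gO t w True) n)" for t w n
    by (rule br[OF F0[of I3] that, of "gO t w False" 1]) (auto simp: simps)
  have O1: "J (Tt (gO s t w) n)" if "n = 1 \<or> n = -1" for s t w n
    using that
  proof
    assume "n = 1"
    with e0(1)[of N0] have "J (Tt (gO False False False) n)" by simp
    then show ?thesis by (cases s; cases t; cases w) (simp_all add: up up2 up3)
  next
    assume "n = -1"
    with e0(2)[of N0] have "J (Tt (gO True True True) n)" by simp
    then show ?thesis by (cases s; cases t; cases w) (simp_all add: dn dn2 dn3)
  qed
  have E1: "J (Tt (gE k) n)" if n: "n = 1 \<or> n = -1" for k n
  proof (cases k)
    case I1 show ?thesis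
      unfolding I1
      by (rule br[OF O[of True True True] O1[OF n, of True False False], of "gE I1" 1]) (auto simp: simps field_simps)
  next
    case I2 show ?thesis
      unfolding I2
      by (rule br[OF O[of True True True] O1[OF n, of False True False], of "gE I2" "- (1 + of_real a)"]) (auto simp: simps field_simps)
  next
    case I3 show ?thesis
      unfolding I3
      by (rule br[OF O[of True True True] O1[OF n, of False False True], of "gE I3" "of_real a"]) (auto simp: simps field_simps)
  qed
  \<comment> \<open>Root vectors are eigenvectors of a suitable \<open>gH\<close> with nonzero
    eigenvalue, so \<open>gH\<close> in degree \<open>d\<close> shifts them. The \<open>gH\<close>
    commute up to the centre, hence those of the new degree come from \<open>H\<close>
    instead.\<close>
  have step: "\<forall>X. J (Tt X (n + d))" if d: "d = 1 \<or> d = -1" and n: "\<forall>X. J (Tt X n)" for n d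
  proof -
    have H1: "J (Tt (gH k) d)" for k using H E1 d by blast
    have E': "J (Tt (gE k) (n + d))" for k
      by (rule br[OF H1[of k] n[rule_format, of "gE k"], of "gE k" 2]) (auto simp: simps)
    have F': "J (Tt (gF k) (n + d))" for k
      by (rule br[OF H1[of k] n[rule_format, of "gF k"], of "gF k" "-2"]) (auto simp: simps)
    have O': "J (Tt (gO s t w) (n + d))" for s t w
      by (rule br[OF H1[of I1] n[rule_format, of "gO s t w"], of "gO s t w" "sg s"]) (auto simp: simps sg_def)
    show ?thesis
    proof
      fix X show "J (Tt X (n + d))" by (cases X) (simp_all add: H[OF E'] E' F' O')
    qed
  qed
  have X0: "\<forall>X. J (Tt X 0)"
  proof
    fix X show "J (Tt X 0)" by (cases X) (simp_all add: H[OF E0] E0 F0 O)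
  qed
  have all: "\<forall>X. J (Tt X n)" for n
  proof (induction n rule: int_induct[where k = 0])
    case base show ?case by (rule X0)
  next
    case (step1 i) then show ?case using step[of 1 i] by simp
  next
    case (step2 i) then show ?case using step[of "-1" i] by simp
  qed
  have "J Kc" unfolding J_def
  proof
    fix u assume u: "u \<in> U"
    \<comment> \<open>The centre is the bracket of \<open>gH I1\<close> in degrees 1 and -1; the
      factor 2 is \<open>cco a I1\<close>.\<close>
    have g: "gbr a (gH I1) (gH I1) Z = (if Z = gH I1 then 0 else 0)" for Z by simp
    have "rho (Tt (gH I1) 1) (rho (Tt (gH I1) (-1)) u) - rho (Tt (gH I1) (-1)) (rho (Tt (gH I1) 1) u)
        = scale 2 (rho Kc u)"
      using comm1[OF g, of 1 "-1" u] by (simp add: simps godd_def)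
    moreover have "rho (Tt (gH I1) 1) (rho (Tt (gH I1) (-1)) u)
        - rho (Tt (gH I1) (-1)) (rho (Tt (gH I1) 1) u) \<in> U"
      using U all u by (intro subspace_diff) (auto simp: J_def)
    ultimately have "scale 2 (rho Kc u) \<in> U" by simp
    then have "scale (inverse 2) (scale 2 (rho Kc u)) \<in> U" by (rule subspace_scale[OF U])
    then show "rho Kc u \<in> U" by simp
  qed
  moreover have "J Dc" using D by (simp add: J_def)
  ultimately have "J b" using all by (cases b) auto
  then show ?thesis using u by (simp add: J_def)
qed

section \<open>Singular vectors and the principal gradation\<close>

text \<open>\<alpha>_i - \<alpha>_j is not a root, so only i = j contributes; the minus sign is that
  of the anticommutator of odd vectors.\<close>

lemma e_f:
  assumes "weight_vec \<mu> x"
  shows "rho (e_gen i) (rho (f_gen j) x)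
    = scale (if i = j then hform a \<mu> (alpha (node_no i)) else 0) x - rho (f_gen j) (rho (e_gen i) x)"
proof -
  have w: "rho (Tt (gH k) 0) x = scale (\<mu> (hH k)) x" "rho Kc x = scale (\<mu> hK) x" for k
    using assms by (auto simp: weight_vec_def)
  show ?thesis
    by (cases i; cases j; simp only: e_gen.simps f_gen.simps; subst comm)
      (simp_all add: gall_def oddbr_def psi_def pp_def dl_def godd_def hform_def alpha_def
        epsw_def deltaw_def w scale_left_distrib scale_left_diff_distrib)
qed

text \<open>The principal gradation: every \<open>\<alpha>\<^sub>i\<close> has height 1.\<close>

definition height :: "(hhat \<Rightarrow> complex) \<Rightarrow> complex" where
  "height \<mu> = 4 * \<mu> hD + \<mu> (hH I1) + \<mu> (hH I2) + \<mu> (hH I3)"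

text \<open>The element of the Cartan subalgebra on which every simple root is 1; the factor 4
  appears because \<delta> is the sum of the four simple roots.\<close>

definition height_op :: "'v \<Rightarrow> 'v" where
  "height_op y = scale 4 (rho Dc y) + rho (Tt (gH I1) 0) y + rho (Tt (gH I2) 0) y + rho (Tt (gH I3) 0) y"

lemma height_op_weight: "weight_vec \<mu> y \<Longrightarrow> height_op y = scale (height \<mu>) y"
  by (simp add: weight_vec_def height_op_def height_def scale_left_distrib)

text \<open>This product kills every vector whose height is below that of \<open>\<Lambda>\<close> by one of \<open>1, \<dots>, n\<close>,
  but not the highest weight vector.\<close>

primrec height_prod :: "nat \<Rightarrow> 'v \<Rightarrow> 'v" where
  "height_prod 0 y = y"
| "height_prod (Suc n) y = height_op (height_prod n y) - scale (height Lam - of_nat (Suc n)) (height_prod n y)"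

lemma height_op_linear: "height_op (x + y) = height_op x + height_op y" "height_op (scale c x) = scale c (height_op x)" "height_op 0 = 0"
  by (simp_all add: height_op_def scale_right_distrib mult.commute)

lemma height_prod_linear: "height_prod n (x + y) = height_prod n x + height_prod n y"
  "height_prod n (scale c x) = scale c (height_prod n x)" "height_prod n 0 = 0"
  by (induction n) (simp_all add: height_op_linear scale_right_diff_distrib scale_right_distrib mult.commute
      del: of_nat_Suc)

lemma height_prod_weight:
  assumes "weight_vec \<mu> y"
  shows "height_prod n y = scale (\<Prod>i<n. height \<mu> - (height Lam - of_nat (Suc i))) y"
proof (induction n)
  case (Suc n)
  let ?p = "\<Prod>i<n. height \<mu> - (height Lam - of_nat (Suc i))"
  have "height_prod (Suc n) y = scale (?p * height \<mu> - (height Lam - of_nat (Suc n)) * ?p) y"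
    by (simp only: height_prod.simps Suc height_op_linear height_op_weight[OF assms] scale_left_diff_distrib scale_scale)
  also have "?p * height \<mu> - (height Lam - of_nat (Suc n)) * ?p
      = (\<Prod>i<Suc n. height \<mu> - (height Lam - of_nat (Suc i)))"
    by (simp only: prod.lessThan_Suc) algebra
  finally show ?case .
qed simp

definition fmon :: "node list \<Rightarrow> 'v \<Rightarrow> 'v" where
  "fmon is x = foldr (\<lambda>i. rho (f_gen i)) is x"

lemma fmon_Nil [simp]: "fmon [] x = x" and fmon_Cons [simp]: "fmon (i # is) x = rho (f_gen i) (fmon is x)"
  by (simp_all add: fmon_def)

lemma weight_f_gen:
  assumes "weight_vec \<mu> x"
  shows "\<exists>\<nu>. weight_vec \<nu> (rho (f_gen i) x) \<and> height \<nu> = height \<mu> - 1"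
proof -
  obtain X n where X: "f_gen i = Tt X n" and
    n: "4 * of_int n + gwt X I1 + gwt X I2 + gwt X I3 = -1"
    by (cases i) (simp_all add: gwt_def osv_def sg_def)
  have "height (\<lambda>h. \<mu> h + awt X n h) = height \<mu> + (4 * of_int n + gwt X I1 + gwt X I2 + gwt X I3)"
    by (simp add: height_def awt_def algebra_simps)
  then show ?thesis using weight_rho[OF assms, of X n] X n by auto
qed

lemma weight_e_gen:
  assumes "weight_vec \<mu> x"
  shows "\<exists>\<nu>. weight_vec \<nu> (rho (e_gen i) x) \<and> height \<nu> = height \<mu> + 1"
proof -
  obtain X n where X: "e_gen i = Tt X n" and
    n: "4 * of_int n + gwt X I1 + gwt X I2 + gwt X I3 = 1"
    by (cases i) (simp_all add: gwt_def osv_def sg_def)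
  have "height (\<lambda>h. \<mu> h + awt X n h) = height \<mu> + (4 * of_int n + gwt X I1 + gwt X I2 + gwt X I3)"
    by (simp add: height_def awt_def algebra_simps)
  then show ?thesis using weight_rho[OF assms, of X n] X n by auto
qed

lemma weight_fmon:
  assumes "weight_vec \<mu> x"
  shows "\<exists>\<nu>. weight_vec \<nu> (fmon is x) \<and> height \<nu> = height \<mu> - of_nat (length is)"
proof (induction "is")
  case Nil then show ?case using assms by auto
next
  case (Cons i "is")
  then obtain \<nu> where "weight_vec \<nu> (fmon is x)" "height \<nu> = height \<mu> - of_nat (length is)" by blast
  with weight_f_gen[of \<nu> "fmon is x" i] show ?case by (auto simp: algebra_simps)
qed

lemma span_invariant:
  assumes S: "\<And>y. y \<in> S \<Longrightarrow> rho b y \<in> span S" and "u \<in> span S"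
  shows "rho b u \<in> span S"
proof -
  have "span S \<subseteq> {u. rho b u \<in> span S}"
    by (rule span_minimal) (auto simp: subspace_def S span_zero span_add span_scale)
  then show ?thesis using assms(2) by blast
qed

text \<open>Every f-monomial on \<open>x\<close> is a weight vector, so moving e_i to the right past
  an f_j leaves only a scalar. The monomials therefore span a submodule, with no ordering as in
  PBW.\<close>

lemma singular_generates:
  assumes w: "weight_vec \<mu> x" and e: "\<And>i. rho (e_gen i) x = 0" and nz: "x \<noteq> 0"
  shows "span (range (\<lambda>is. fmon is x)) = UNIV"
proof -
  let ?S = "range (\<lambda>is. fmon is x)"
  have f: "rho (f_gen i) y \<in> span ?S" if "y \<in> span ?S" for i y
  proof (rule span_invariant[OF _ that])
    fix y assume "y \<in> ?S"
    then obtain "is" where "y = fmon is x" by blast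
    then have "rho (f_gen i) y = fmon (i # is) x" by simp
    then show "rho (f_gen i) y \<in> span ?S" by (metis rangeI span_base)
  qed
  have e1: "rho (e_gen i) (fmon is x) \<in> span ?S" for i "is"
  proof (induction "is")
    case Nil then show ?case by (simp add: e span_zero)
  next
    case (Cons j "is")
    obtain \<nu> where "weight_vec \<nu> (fmon is x)" using weight_fmon[OF w] by blast
    show ?case
      unfolding fmon_Cons e_f[OF \<open>weight_vec \<nu> (fmon is x)\<close>]
      by (intro span_diff span_scale f Cons) (simp add: span_base)
  qed
  have e: "rho (e_gen i) y \<in> span ?S" if "y \<in> span ?S" for i y
    by (rule span_invariant[OF _ that]) (auto intro: e1)
  have D: "rho Dc y \<in> span ?S" if "y \<in> span ?S" for y
  proof (rule span_invariant[OF _ that])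
    fix y assume "y \<in> ?S"
    then obtain "is" where y: "y = fmon is x" by blast
    obtain \<nu> where "weight_vec \<nu> (fmon is x)" using weight_fmon[OF w] by blast
    then show "rho Dc y \<in> span ?S" unfolding y weight_vec_def by (simp add: span_scale span_base)
  qed
  have "rho b u \<in> span ?S" if "u \<in> span ?S" for b u
    by (rule invariant_generated[OF subspace_span e f D that])
  then have "span ?S = {0} \<or> span ?S = UNIV" by (intro irreducible subspace_span)
  moreover have "x \<in> span ?S" by (rule span_base) (metis fmon_Nil rangeI)
  ultimately show ?thesis using nz by blast
qed

text \<open>Otherwise the f-monomials on \<open>x\<close> would span the whole module. They lie in
  \<open>U\<close>, the vectors killed by all long enough products \<open>height_prod\<close>, but
  \<open>v0\<close> does not; no independence of weight spaces is required.\<close>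

lemma singular_zero:
  assumes w: "weight_vec \<mu> x" and h: "height \<mu> = height Lam - of_nat s" "s > 0" and e: "\<And>i. rho (e_gen i) x = 0"
  shows "x = 0"
proof (rule ccontr)
  assume nz: "x \<noteq> 0"
  define U where "U = {y. \<exists>N. \<forall>n\<ge>N. height_prod n y = 0}"
  have "subspace U"
    unfolding subspace_def
  proof (intro conjI ballI allI)
    show "0 \<in> U" by (simp add: U_def height_prod_linear)
    fix y z assume "y \<in> U" "z \<in> U"
    then obtain N M where "\<forall>n\<ge>N. height_prod n y = 0" "\<forall>n\<ge>M. height_prod n z = 0" by (auto simp: U_def)
    then have "\<forall>n\<ge>max N M. height_prod n (y + z) = 0" by (simp add: height_prod_linear)
    then show "y + z \<in> U" unfolding U_def by blast
  next
    fix c y assume "y \<in> U" then show "scale c y \<in> U" by (auto simp: U_def height_prod_linear)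
  qed
  moreover have "range (\<lambda>is. fmon is x) \<subseteq> U"
  proof
    fix y assume "y \<in> range (\<lambda>is. fmon is x)"
    then obtain "is" where y: "y = fmon is x" by blast
    obtain \<nu> where n: "weight_vec \<nu> y" "height \<nu> = height \<mu> - of_nat (length is)"
      using weight_fmon[OF w] y by blast
    define r where "r = s + length is"
    have r: "r > 0" "height \<nu> = height Lam - of_nat r" using n h by (simp_all add: r_def)
    have "height_prod n y = 0" if "n \<ge> r" for n
    proof -
      \<comment> \<open>The factor with \<open>Suc i = r\<close> is zero; the product starts at 1,
        so \<open>r > 0\<close> is essential.\<close>
      have "(\<Prod>i<n. height \<nu> - (height Lam - of_nat (Suc i))) = 0"
        using r that by (intro prod_zero) (auto intro!: bexI[of _ "r - 1"])
      then show ?thesis by (simp add: height_prod_weight[OF n(1)])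
    qed
    then show "y \<in> U" unfolding U_def by blast
  qed
  ultimately have "U = UNIV"
    using singular_generates[OF w e nz] span_minimal by blast
  then obtain N where "height_prod N v0 = 0" by (auto simp: U_def)
  \<comment> \<open>On \<open>v0\<close> the factors are the positive integers \<open>Suc i\<close>,
    so the product cannot vanish.\<close>
  then have "(\<Prod>i<N. height Lam - (height Lam - of_nat (Suc i))) = (0::complex)"
    using height_prod_weight[OF weight_v0, of N] v0_nonzero by simp
  then show False by (simp del: of_nat_Suc)
qed

section \<open>Vectors on which an even root vector is nilpotent\<close>

lemma rho_pow_zero: "(rho c ^^ N) x = 0 \<Longrightarrow> N \<le> n \<Longrightarrow> (rho c ^^ n) x = 0"
proof -
  assume x: "(rho c ^^ N) x = 0" and "N \<le> n"
  then obtain d where d: "n = d + N" by (metis add.commute le_Suc_ex)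
  have "(rho c ^^ d) 0 = 0" by (induction d) simp_all
  then show ?thesis by (simp add: d funpow_add x)
qed

lemma rho_pow_lin: "(rho c ^^ n) (x + y) = (rho c ^^ n) x + (rho c ^^ n) y"
  "(rho c ^^ n) (scale t x) = scale t ((rho c ^^ n) x)" "(rho c ^^ n) 0 = 0"
  by (induction n) simp_all

lemma subspace_nilvec: "subspace (nilvec (rho c))"
  unfolding subspace_def nilvec_def
proof (intro conjI ballI allI; clarsimp)
  show "\<exists>N. (rho c ^^ N) 0 = 0" by (simp add: rho_pow_lin)
next
  fix x y N M assume "(rho c ^^ N) x = 0" "(rho c ^^ M) y = 0"
  then have "(rho c ^^ max N M) (x + y) = 0"
    by (simp add: rho_pow_lin rho_pow_zero[of N c x] rho_pow_zero[of M c y])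
  then show "\<exists>N. (rho c ^^ N) (x + y) = 0" by blast
next
  fix x N t assume "(rho c ^^ N) x = 0"
  then show "\<exists>N. (rho c ^^ N) (scale t x) = 0" by (intro exI[of _ N]) (simp add: rho_pow_lin)
qed

lemma nilvec_pull: "rho c x \<in> nilvec (rho c) \<Longrightarrow> x \<in> nilvec (rho c)"
proof -
  assume "rho c x \<in> nilvec (rho c)"
  then obtain N where "(rho c ^^ N) (rho c x) = 0" by (auto simp: nilvec_def)
  then have "(rho c ^^ Suc N) x = 0" by (simp add: funpow_swap1)
  then show ?thesis unfolding nilvec_def by blast
qed

text \<open>Induction on the order of nilpotency: \<open>rho c x\<close> has smaller order, so
  \<open>rho c\<close> sends \<open>rho b x\<close> into the space, and \<open>nilvec_pull\<close>
  brings \<open>rho b x\<close> itself back.\<close>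

lemma nilvec_step:
  assumes br: "\<And>x. rho c (rho b x) = rho b (rho c x) + w x"
    and w: "\<And>x. x \<in> nilvec (rho c) \<Longrightarrow> w x \<in> nilvec (rho c)"
    and x: "x \<in> nilvec (rho c)"
  shows "rho b x \<in> nilvec (rho c)"
proof -
  have "rho b x \<in> nilvec (rho c)" if "(rho c ^^ N) x = 0" for N x
    using that
  proof (induction N arbitrary: x)
    case 0 then show ?case by (simp add: subspace_0[OF subspace_nilvec])
  next
    case (Suc N)
    then have "rho b (rho c x) \<in> nilvec (rho c)" by (simp add: funpow_swap1)
    moreover have "w x \<in> nilvec (rho c)"
      using Suc.prems by (intro w) (unfold nilvec_def, blast)
    ultimately have "rho c (rho b x) \<in> nilvec (rho c)"
      unfolding br by (intro subspace_add[OF subspace_nilvec])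
    then show ?case by (rule nilvec_pull)
  qed
  then show ?thesis using x by (auto simp: nilvec_def)
qed

lemma osv_eta: "osv (s I1) (s I2) (s I3) = s"
  by (auto simp: fun_eq_iff osv_def split: idx.split)

text \<open>The adjoint action of an even real root vector is nilpotent, so basis vectors are
  treated by the length of their string: the centre, vectors commuting with \<open>X\<close> up to
  the centre, then \<open>gH\<close>, then the opposite root vectors, and likewise the odd vectors.
  Each commutator falls on a case already settled.\<close>

lemma nilvec_invariant:
  assumes X: "X = gE k \<or> X = gF k" and x: "x \<in> nilvec (rho (Tt X m))"
  shows "rho b x \<in> nilvec (rho (Tt X m))"
proof -
  let ?z = "rho (Tt X m)"
  define J where "J b \<longleftrightarrow> (\<forall>x\<in>nilvec ?z. rho b x \<in> nilvec ?z)" for b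
  have J: "J b" if "\<And>x. ?z (rho b x) = rho b (?z x) + w x"
      "\<And>x. x \<in> nilvec ?z \<Longrightarrow> w x \<in> nilvec ?z" for b w
    unfolding J_def using nilvec_step[of "Tt X m" b w, OF that] by blast
  have sc: "scale t x \<in> nilvec ?z" if "x \<in> nilvec ?z" for t x
    by (rule subspace_scale[OF subspace_nilvec that])
  have K: "J Kc" by (rule J[of _ "\<lambda>_. 0"]) (simp_all add: K_comm subspace_0[OF subspace_nilvec])
  have self: "?z x \<in> nilvec ?z" if "x \<in> nilvec ?z" for x
  proof -
    obtain N where "(?z ^^ N) x = 0" using \<open>x \<in> nilvec ?z\<close> by (auto simp: nilvec_def)
    then have "(?z ^^ N) (?z x) = 0" by (simp add: funpow_swap1[symmetric])
    then show ?thesis unfolding nilvec_def by blast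
  qed
  have D: "J Dc"
  proof (rule J[of _ "\<lambda>x. scale (- of_int m) (?z x)"])
    show "?z (rho Dc x) = rho Dc (?z x) + scale (- of_int m) (?z x)" for x
      by (simp add: D_comm)
  qed (intro sc self)
  have even: "\<not> godd X" using X by (auto simp: godd_def)
  have J2: "J (Tt Y n)" if Z: "\<And>Z. gbr a X Y Z = (if Z = V then c else 0)"
    and V: "J (Tt V (m + n))" for Y V c n
  proof (rule J[of _ "\<lambda>x. scale c (rho (Tt V (m + n)) x)
          + scale (of_int m * (if m + n = 0 then gform a X Y else 0)) (rho Kc x)"])
    show "?z (rho (Tt Y n) x) = rho (Tt Y n) (?z x) + (scale c (rho (Tt V (m + n)) x)
          + scale (of_int m * (if m + n = 0 then gform a X Y else 0)) (rho Kc x))" for x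
      using comm1[OF Z, of m n x] even by simp
    show "scale c (rho (Tt V (m + n)) x)
          + scale (of_int m * (if m + n = 0 then gform a X Y else 0)) (rho Kc x) \<in> nilvec ?z"
      if "x \<in> nilvec ?z" for x
      using that V K by (intro subspace_add[OF subspace_nilvec] sc) (auto simp: J_def)
  qed
  have J1: "J (Tt Y n)" if Z: "\<And>Z. gbr a X Y Z = 0" for Y n
  proof (rule J[of _ "\<lambda>x. scale (of_int m * (if m + n = 0 then gform a X Y else 0)) (rho Kc x)"])
    have Z: "gbr a X Y Z = (if Z = Y then 0 else 0)" for Z using Z by simp
    show "?z (rho (Tt Y n) x) = rho (Tt Y n) (?z x)
          + scale (of_int m * (if m + n = 0 then gform a X Y else 0)) (rho Kc x)" for x
      using comm1[OF Z, of m n x] even by simp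
    show "scale (of_int m * (if m + n = 0 then gform a X Y else 0)) (rho Kc x) \<in> nilvec ?z"
      if "x \<in> nilvec ?z" for x
      using that K by (intro sc) (auto simp: J_def)
  qed
  have "J (Tt Y n)" for Y n
    using X
  proof
    assume X: "X = gE k"
    have E: "J (Tt (gE j) n)" for j n by (rule J1) (simp add: X)
    have H: "J (Tt (gH j) n)" for j n
      by (rule J2[where V = "gE k" and c = "if j = k then -2 else 0"]) (auto simp: X E dl_def)
    have F: "J (Tt (gF j) n)" for j n
      by (rule J2[where V = "gH k" and c = "if j = k then 1 else 0"]) (auto simp: X H dl_def)
    have O: "J (Tt (gO s t w) n)" if "osv s t w k" for s t w n
      by (rule J1) (simp add: X that)
    then have O': "J (Tt (mkO r) n)" if "r k" for r n
      unfolding mkO_def using that by (metis osv_eta)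
    have "J (Tt (gO s t w) n)" if "\<not> osv s t w k" for s t w n
      by (rule J2[where V = "mkO ((osv s t w)(k := True))" and c = 1])
        (use that in \<open>auto simp: X dl_def intro!: O'\<close>)
    with E H F O show ?thesis by (cases Y) blast+
  next
    assume X: "X = gF k"
    have E: "J (Tt (gF j) n)" for j n by (rule J1) (simp add: X)
    have H: "J (Tt (gH j) n)" for j n
      by (rule J2[where V = "gF k" and c = "if j = k then 2 else 0"]) (auto simp: X E dl_def)
    have F: "J (Tt (gE j) n)" for j n
      by (rule J2[where V = "gH k" and c = "if j = k then -1 else 0"]) (auto simp: X H dl_def)
    have O: "J (Tt (gO s t w) n)" if "\<not> osv s t w k" for s t w n
      by (rule J1) (simp add: X that)
    then have O': "J (Tt (mkO r) n)" if "\<not> r k" for r n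
      unfolding mkO_def using that by (metis osv_eta)
    have "J (Tt (gO s t w) n)" if "osv s t w k" for s t w n
      by (rule J2[where V = "mkO ((osv s t w)(k := False))" and c = 1])
        (use that in \<open>auto simp: X dl_def intro!: O'\<close>)
    with E H F O show ?thesis by (cases Y) blast+
  qed
  then have "J b" using K D by (cases b) auto
  then show ?thesis using x by (simp add: J_def)
qed

lemma locnil_rho_iff:
  assumes X: "X = gE k \<or> X = gF k" and x: "x \<noteq> 0"
  shows "locnil (rho (Tt X m)) \<longleftrightarrow> (\<exists>N. (rho (Tt X m) ^^ N) x = 0)"
proof
  assume "\<exists>N. (rho (Tt X m) ^^ N) x = 0"
  then have "x \<in> nilvec (rho (Tt X m))" by (simp add: nilvec_def)
  moreover have "nilvec (rho (Tt X m)) = {0} \<or> nilvec (rho (Tt X m)) = UNIV"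
    using nilvec_invariant[OF X] by (intro irreducible subspace_nilvec)
  ultimately have "nilvec (rho (Tt X m)) = UNIV" using x by blast
  then show "locnil (rho (Tt X m))" by (auto simp: nilvec_def locnil_def)
qed (simp add: locnil_def)

section \<open>sl(2)-triples of the pairs and their brackets\<close>

text \<open>The value of \<open>\<mu>\<close> on the coroot of \<open>\<alpha>\<^sub>i + \<alpha>\<^sub>j\<close>.\<close>

definition coroot :: "node \<Rightarrow> node \<Rightarrow> (hhat \<Rightarrow> complex) \<Rightarrow> complex" where
  "coroot i j \<mu> = (if i = N0 \<or> j = N0 then \<mu> hK * cco a (pair_idx i j) / 2 - \<mu> (hH (pair_idx i j)) else \<mu> (hH (pair_idx i j)))"

text \<open>\<open>2 * bco a (pair_idx i j)\<close> is (\<alpha>_i | \<alpha>_j), half the square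
  length of \<alpha>_i + \<alpha>_j, so the right side is 2(\<mu> | \<gamma>)/(\<gamma> | \<gamma>)
  for \<gamma> = \<alpha>_i + \<alpha>_j.\<close>

lemma coroot_hform:
  assumes "i \<noteq> j"
  shows "coroot i j \<mu> = (hform a \<mu> (alpha (node_no i)) + hform a \<mu> (alpha (node_no j))) / (2 * bco a (pair_idx i j))"
  using assms bco_nonzero[of "pair_idx i j"]
  by (cases i; cases j) (simp_all add: coroot_def hform_def alpha_def epsw_def deltaw_def dl_def cco_def field_simps)

lemma coroot_sym: "coroot i j = coroot j i" and f_pair_sym: "f_pair i j = f_pair j i"
  by (cases i; cases j; simp add: coroot_def e_pair_def f_pair_def fun_eq_iff)+

lemma self_neg_zero: "y = - y \<Longrightarrow> y = (0::'v)"
proof -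
  assume "y = - y"
  then have "y + y = 0" by (metis add.right_inverse)
  then have "scale 2 y = 0" using scale_left_distrib[of 1 1 y] by simp
  then show ?thesis by simp
qed

text \<open>2\<alpha>_i is not a root, so the anticommutator of e_i with itself, twice its square,
  is zero.\<close>

lemma e_e: "rho (e_gen i) (rho (e_gen i) x) = 0"
  by (rule self_neg_zero, cases i; simp only: e_gen.simps; subst comm)
    (simp_all add: gall_def oddbr_def psi_def godd_def)

lemma f_f: "rho (f_gen i) (rho (f_gen i) x) = 0"
  by (rule self_neg_zero, cases i; simp only: f_gen.simps; subst comm)
    (simp_all add: gall_def oddbr_def psi_def godd_def)

lemma ee_ff:
  assumes "weight_vec \<mu> x" "i \<noteq> j"
  shows "rho (e_pair i j) (rho (f_pair i j) x) = rho (f_pair i j) (rho (e_pair i j) x) + scale (coroot i j \<mu>) x"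
proof -
  have w: "rho (Tt (gH k) 0) x = scale (\<mu> (hH k)) x" "rho Kc x = scale (\<mu> hK) x" for k
    using assms by (auto simp: weight_vec_def)
  have 1: "gbr a (gE k) (gF k) Z = (if Z = gH k then 1 else 0)" 
    "gbr a (gF k) (gE k) Z = (if Z = gH k then -1 else 0)" for k Z by (auto simp: dl_def)
  show ?thesis
  proof (cases "i = N0 \<or> j = N0")
    case True
    then show ?thesis using comm1[OF 1(2), of "pair_idx i j" 1 "-1" x]
      by (simp add: e_pair_def f_pair_def coroot_def w godd_def scale_left_diff_distrib mult.commute)
  next
    case False
    then show ?thesis using comm1[OF 1(1), of "pair_idx i j" 0 0 x]
      by (simp add: e_pair_def f_pair_def coroot_def w godd_def)
  qed
qed

lemma f_ff:
  assumes "i \<noteq> j"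
  shows "rho (f_gen i) (rho (f_pair i j) x) = rho (f_pair i j) (rho (f_gen i) x)"
  using assms by (cases i; cases j; simp add: f_pair_def; subst comm)
    (simp_all add: gall_def dl_def godd_def osv_def)

lemma e_ff_other:
  assumes "i \<noteq> j" "k \<noteq> i" "k \<noteq> j"
  shows "rho (e_gen k) (rho (f_pair i j) x) = rho (f_pair i j) (rho (e_gen k) x)"
  using assms by (cases i; cases j; cases k; simp add: f_pair_def; subst comm)
    (simp_all add: gall_def dl_def godd_def osv_def)

text \<open>[e_j, f_ij] is a multiple of f_i, which disappears on vectors killed by f_i: this is the
  gain from passing to f_i v0.\<close>

lemma e_ff:
  assumes "i \<noteq> j" "rho (f_gen i) x = 0"
  shows "rho (e_gen j) (rho (f_pair i j) x) = rho (f_pair i j) (rho (e_gen j) x)"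
  using assms by (cases i; cases j; simp add: f_pair_def; subst comm)
    (simp_all add: gall_def dl_def godd_def osv_def mkO_def)

lemma e_e_other:
  assumes "k \<noteq> i" "rho (e_pair i k) x = 0"
  shows "rho (e_gen k) (rho (e_gen i) x) = - rho (e_gen i) (rho (e_gen k) x)"
  using assms by (cases i; cases k; simp add: e_pair_def; subst comm)
    (simp_all add: gall_def dl_def godd_def oddbr_def psi_def pp_def)

text \<open>The bracket would have weight \<alpha>_k - \<alpha>_j, which is not a root.\<close>

lemma ee_ff_other:
  assumes "i \<noteq> j" "k \<noteq> i" "k \<noteq> j"
  shows "rho (e_pair i k) (rho (f_pair i j) x) = rho (f_pair i j) (rho (e_pair i k) x)"
  using assms by (cases i; cases j; cases k; simp add: e_pair_def f_pair_def; subst comm)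
    (simp_all add: gall_def dl_def godd_def)

text \<open>[e_ik, f_i] is a multiple of e_k.\<close>

lemma ee_f:
  assumes "k \<noteq> i" "rho (e_gen k) x = 0"
  shows "rho (e_pair i k) (rho (f_gen i) x) = rho (f_gen i) (rho (e_pair i k) x)"
  using assms by (cases i; cases k; simp add: e_pair_def; subst comm)
    (simp_all add: gall_def dl_def godd_def osv_def mkO_def)

lemma f_f_other:
  assumes "i \<noteq> j"
  shows "rho (f_gen i) (rho (f_gen j) x) = scale (2 * bco a (pair_idx i j)) (rho (f_pair i j) x) - rho (f_gen j) (rho (f_gen i) x)"
  using assms by (cases i; cases j; simp add: f_pair_def; subst comm)
    (simp_all add: gall_def dl_def godd_def oddbr_def psi_def pp_def)

lemma ee_v0: "rho (e_pair i j) v0 = 0"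
  using is_L_D(9,10)[OF isL] by (cases "pair_idx i j") (simp_all add: e_pair_def gpos_def)

lemma f_pair_root: "\<exists>X m k. f_pair i j = Tt X m \<and> (X = gE k \<or> X = gF k)"
  by (cases "i = N0 \<or> j = N0") (simp_all only: f_pair_def if_True if_False, blast+)

lemma weight_f_pair:
  assumes "weight_vec \<mu> x" "i \<noteq> j"
  shows "\<exists>\<nu>. weight_vec \<nu> (rho (f_pair i j) x) \<and> height \<nu> = height \<mu> - 2 \<and> coroot i j \<nu> = coroot i j \<mu> - 2"
proof -
  obtain X n where X: "f_pair i j = Tt X n" and
    n: "4 * of_int n + gwt X I1 + gwt X I2 + gwt X I3 = -2" and
    p: "(if i = N0 \<or> j = N0 then - gwt X (pair_idx i j) else gwt X (pair_idx i j)) = -2"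
  proof (cases "i = N0 \<or> j = N0")
    case True
    then show thesis
      by (intro that[of "gE (pair_idx i j)" "-1"]) (cases "pair_idx i j"; simp add: f_pair_def gwt_def dl_def)+
  next
    case False
    then show thesis
      by (intro that[of "gF (pair_idx i j)" 0]) (cases "pair_idx i j"; simp add: f_pair_def gwt_def dl_def)+
  qed
  have "height (\<lambda>h. \<mu> h + awt X n h) = height \<mu> + (4 * of_int n + gwt X I1 + gwt X I2 + gwt X I3)"
    by (simp add: height_def awt_def algebra_simps)
  moreover have "coroot i j (\<lambda>h. \<mu> h + awt X n h)
      = coroot i j \<mu> + (if i = N0 \<or> j = N0 then - gwt X (pair_idx i j) else gwt X (pair_idx i j))"
    by (simp add: coroot_def awt_def)
  ultimately show ?thesis using weight_rho[OF assms(1), of X n] X n p by auto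
qed

lemma weight_f_gen_coroot:
  assumes "weight_vec \<mu> x" "i \<noteq> j"
  shows "\<exists>\<nu>. weight_vec \<nu> (rho (f_gen i) x) \<and> height \<nu> = height \<mu> - 1 \<and> coroot i j \<nu> = coroot i j \<mu> - 1"
proof -
  obtain X n where X: "f_gen i = Tt X n" and
    n: "4 * of_int n + gwt X I1 + gwt X I2 + gwt X I3 = -1" and
    p: "(if i = N0 \<or> j = N0 then - gwt X (pair_idx i j) else gwt X (pair_idx i j)) = -1"
    using assms(2) by (cases i; cases j) (auto simp add: gwt_def osv_def sg_def)
  have "height (\<lambda>h. \<mu> h + awt X n h) = height \<mu> + (4 * of_int n + gwt X I1 + gwt X I2 + gwt X I3)"
    by (simp add: height_def awt_def algebra_simps)
  moreover have "coroot i j (\<lambda>h. \<mu> h + awt X n h)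
      = coroot i j \<mu> + (if i = N0 \<or> j = N0 then - gwt X (pair_idx i j) else gwt X (pair_idx i j))"
    by (simp add: coroot_def awt_def)
  ultimately show ?thesis using weight_rho[OF assms(1), of X n] X n p by auto
qed

lemma weight_f_pair_pow:
  assumes "weight_vec \<mu> x" "i \<noteq> j"
  shows "\<exists>\<nu>. weight_vec \<nu> ((rho (f_pair i j) ^^ n) x) \<and> height \<nu> = height \<mu> - 2 * of_nat n
    \<and> coroot i j \<nu> = coroot i j \<mu> - 2 * of_nat n"
proof (induction n)
  case 0 then show ?case using assms by auto
next
  case (Suc n)
  then obtain \<nu> where "weight_vec \<nu> ((rho (f_pair i j) ^^ n) x)" "height \<nu> = height \<mu> - 2 * of_nat n"
    "coroot i j \<nu> = coroot i j \<mu> - 2 * of_nat n" by blast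
  with weight_f_pair[OF this(1) assms(2)] show ?case by (auto simp: algebra_simps)
qed

text \<open>The coroot values of the successive powers add up: \<lambda> + (\<lambda> - 2) + ... +
  (\<lambda> - 2n) = (n + 1)(\<lambda> - n).\<close>

lemma ee_ff_pow:
  assumes w: "weight_vec \<mu> x" and ij: "i \<noteq> j" and e: "rho (e_pair i j) x = 0"
  shows "rho (e_pair i j) ((rho (f_pair i j) ^^ Suc n) x)
    = scale (of_nat (Suc n) * (coroot i j \<mu> - of_nat n)) ((rho (f_pair i j) ^^ n) x)"
proof (induction n)
  case 0 then show ?case using ee_ff[OF w ij] e by simp
next
  case (Suc n)
  let ?y = "(rho (f_pair i j) ^^ Suc n) x"
  obtain \<nu> where n: "weight_vec \<nu> ?y" "coroot i j \<nu> = coroot i j \<mu> - 2 * of_nat (Suc n)"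
    using weight_f_pair_pow[OF w ij] by blast
  have "rho (e_pair i j) ((rho (f_pair i j) ^^ Suc (Suc n)) x)
      = rho (f_pair i j) (rho (e_pair i j) ?y) + scale (coroot i j \<nu>) ?y"
    using ee_ff[OF n(1) ij] by simp
  also have "\<dots> = scale (of_nat (Suc n) * (coroot i j \<mu> - of_nat n) + coroot i j \<nu>) ?y"
    unfolding Suc by (simp add: scale_left_distrib)
  also have "of_nat (Suc n) * (coroot i j \<mu> - of_nat n) + coroot i j \<nu>
      = of_nat (Suc (Suc n)) * (coroot i j \<mu> - of_nat (Suc n))"
    unfolding n(2) by (simp add: algebra_simps)
  finally show ?case .
qed

lemma sl2_nilpotent_imp_Nats:
  assumes w: "weight_vec \<mu> x" and ij: "i \<noteq> j" and e: "rho (e_pair i j) x = 0" and x: "x \<noteq> 0"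
    and N: "(rho (f_pair i j) ^^ N) x = 0"
  shows "coroot i j \<mu> \<in> \<nat>"
proof -
  define M where "M = (LEAST N. (rho (f_pair i j) ^^ N) x = 0)"
  have M: "(rho (f_pair i j) ^^ M) x = 0" unfolding M_def using N by (rule LeastI)
  have "M \<noteq> 0" using M x by (metis funpow_0)
  then obtain n where n: "M = Suc n" by (cases M) auto
  have "(rho (f_pair i j) ^^ n) x \<noteq> 0" using not_less_Least[of n "\<lambda>N. (rho (f_pair i j) ^^ N) x = 0"] n M_def by auto
  then have "of_nat (Suc n) * (coroot i j \<mu> - of_nat n) = 0"
    using ee_ff_pow[OF w ij e, of n] M n by (simp del: funpow.simps of_nat_Suc)
  then have "coroot i j \<mu> = of_nat n" by (simp del: of_nat_Suc)
  then show ?thesis by simp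
qed

section \<open>Odd reflection and the criterion for one pair\<close>

text \<open>For the base reflected at \<alpha>_i the vector f_i v0 has highest weight and \<alpha>_i
  + \<alpha>_j is simple, so the usual sl(2) criterion holds with the coroot value of f_i
  v0.\<close>

lemma locnil_odd_reflection:
  assumes ij: "i \<noteq> j" and m: "hform a Lam (alpha (node_no i)) \<noteq> 0"
  shows "locnil (rho (f_pair i j)) \<longleftrightarrow> coroot i j Lam - 1 \<in> \<nat>"
proof -
  let ?F = "rho (f_pair i j)" and ?v = "rho (f_gen i) v0"
  have ev: "rho (e_gen k) ?v = (if k = i then scale (hform a Lam (alpha (node_no i))) v0 else 0)" for k
    using e_f[OF weight_v0, of k i] by (simp add: e_v0)
  have v: "?v \<noteq> 0" using ev[of i] m v0_nonzero by auto
  obtain \<mu> where mu: "weight_vec \<mu> ?v" "height \<mu> = height Lam - 1" "coroot i j \<mu> = coroot i j Lam - 1"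
    using weight_f_gen_coroot[OF weight_v0 ij] by blast
  have eev: "rho (e_pair i k) ?v = 0" if "k \<noteq> i" for k
    using ee_f[OF that e_v0] by (simp add: ee_v0)
  obtain X n k where X: "f_pair i j = Tt X n" "X = gE k \<or> X = gF k" using f_pair_root by blast
  have iff: "locnil ?F \<longleftrightarrow> (\<exists>N. (?F ^^ N) ?v = 0)"
    using locnil_rho_iff[OF X(2) v] X(1) by simp
  show ?thesis
  proof
    assume "locnil ?F"
    then show "coroot i j Lam - 1 \<in> \<nat>"
      using sl2_nilpotent_imp_Nats[OF mu(1) ij eev[OF ij[symmetric]] v] mu(3) iff by auto
  next
    assume "coroot i j Lam - 1 \<in> \<nat>"
    then obtain n where n: "coroot i j \<mu> = of_nat n" using mu(3) by (auto elim: Nats_cases)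
    \<comment> \<open>\<open>n\<close> is the value at \<mu>, one less than at \<Lambda>; at the
      exponent \<open>Suc n\<close> the coefficient in \<open>ee_ff_pow\<close> vanishes.\<close>
    define u where "u = (?F ^^ Suc n) ?v"
    have fF: "rho (f_gen i) ((?F ^^ p) ?v) = 0" for p
      by (induction p) (simp_all add: f_f f_ff[OF ij])
    have ej: "rho (e_gen j) ((?F ^^ p) ?v) = 0" for p
      by (induction p) (simp_all add: ev ij[symmetric] e_ff[OF ij fF])
    have ek: "rho (e_gen k) ((?F ^^ p) ?v) = 0" if "k \<noteq> i" "k \<noteq> j" for k p
      by (induction p) (simp_all add: ev that e_ff_other[OF ij that])
    have eek: "rho (e_pair i k) ((?F ^^ p) ?v) = 0" if "k \<noteq> i" "k \<noteq> j" for k p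
    proof (induction p)
      case 0 show ?case using eev[OF that(1)] by simp
    next
      case (Suc p)
      show ?case using ee_ff_other[OF ij that, of "(?F ^^ p) ?v"] by (simp only: funpow.simps comp_apply Suc rho_zero)
    qed
    have e: "rho (e_gen k) u = 0" if "k \<noteq> i" for k
      unfolding u_def using ej ek that by (cases "k = j") blast+
    have ee: "rho (e_pair i k) u = 0" if "k \<noteq> i" for k
    proof (cases "k = j")
      case True
      then show ?thesis
        using ee_ff_pow[OF mu(1) ij eev[OF ij[symmetric]], of n] n by (simp add: u_def del: funpow.simps)
    next
      case False
      then show ?thesis unfolding u_def using eek that by blast
    qed
    obtain \<nu> where nu: "weight_vec \<nu> u" "height \<nu> = height \<mu> - 2 * of_nat (Suc n)"
      unfolding u_def using weight_f_pair_pow[OF mu(1) ij] by blast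
    obtain \<nu>' where nu': "weight_vec \<nu>' (rho (e_gen i) u)" "height \<nu>' = height \<nu> + 1"
      using weight_e_gen[OF nu(1)] by blast
    \<comment> \<open>e_i squares to zero; for k \<noteq> i, e_k anticommutes with e_i on
      \<open>u\<close> because e_ik kills \<open>u\<close>.\<close>
    have ey: "rho (e_gen k) (rho (e_gen i) u) = 0" for k
    proof (cases "k = i")
      case False
      then show ?thesis using e_e_other[OF False ee[OF False]] e[OF False] by simp
    qed (simp add: e_e)
    \<comment> \<open>\<open>u\<close> lies 1 + 2(n + 1) below \<Lambda>, and e_i raises it by
      1.\<close>
    have "height \<nu>' = height Lam - of_nat (2 * n + 2)" using nu'(2) nu(2) mu(2) by simp
    from singular_zero[OF nu'(1) this _ ey] have "rho (e_gen i) u = 0" by simp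
    then have eu: "rho (e_gen k) u = 0" for k using e by (cases "k = i") auto
    have "height \<nu> = height Lam - of_nat (2 * n + 3)" using nu(2) mu(2) by simp
    from singular_zero[OF nu(1) this _ eu] have "u = 0" by simp
    then show "locnil ?F" using iff unfolding u_def by blast
  qed
qed

lemma Nats_diff_1_iff: "(z::complex) - 1 \<in> \<nat> \<longleftrightarrow> z \<in> \<nat> \<and> z \<noteq> 0"
proof
  assume "z - 1 \<in> \<nat>"
  then obtain n where "z - 1 = of_nat n" by (elim Nats_cases)
  then have z: "z = of_nat (Suc n)" by (simp add: algebra_simps)
  show "z \<in> \<nat> \<and> z \<noteq> 0" unfolding z by (simp del: of_nat_Suc)
next
  assume "z \<in> \<nat> \<and> z \<noteq> 0"
  then obtain n where "z = of_nat n" "n \<noteq> 0" by (auto elim: Nats_cases)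
  then have "z - 1 = of_nat (n - 1)" by (simp add: of_nat_diff)
  then show "z - 1 \<in> \<nat>" by simp
qed

lemma locnil_f_pair_iff:
  assumes ij: "i \<noteq> j"
  shows "locnil (rho (f_pair i j)) \<longleftrightarrow> coroot i j Lam \<in> \<nat>
    \<and> (coroot i j Lam = 0 \<longrightarrow> hform a Lam (alpha (node_no i)) = 0 \<and> hform a Lam (alpha (node_no j)) = 0)"
proof (cases "hform a Lam (alpha (node_no i)) = 0 \<and> hform a Lam (alpha (node_no j)) = 0")
  case True
  have z: "rho (f_gen k) v0 = 0" if "k = i \<or> k = j" for k
  proof -
    obtain \<nu> where nu: "weight_vec \<nu> (rho (f_gen k) v0)" "height \<nu> = height Lam - 1" using weight_f_gen[OF weight_v0] by blast
    have "rho (e_gen l) (rho (f_gen k) v0) = 0" for l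
      using e_f[OF weight_v0, of l k] True that by (auto simp: e_v0)
    with nu show ?thesis using singular_zero[OF nu(1), of 1] by simp
  qed
  have "scale (2 * bco a (pair_idx i j)) (rho (f_pair i j) v0) = 0"
    using f_f_other[OF ij, of v0] z by simp
  then have "rho (f_pair i j) v0 = 0" using bco_nonzero by simp
  then have "(rho (f_pair i j) ^^ 1) v0 = 0" by simp
  moreover obtain X n k where X: "f_pair i j = Tt X n" "X = gE k \<or> X = gF k" using f_pair_root by blast
  ultimately have "locnil (rho (f_pair i j))" using locnil_rho_iff[OF X(2) v0_nonzero] by metis
  moreover have "coroot i j Lam = 0" using True by (simp add: coroot_hform[OF ij])
  ultimately show ?thesis using True by simp
next
  case False
  \<comment> \<open>Whichever of the two labels is nonzero serves as the node of reflection;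
    shifting the value by one turns into excluding the value 0.\<close>
  then show ?thesis
    using locnil_odd_reflection[OF ij] locnil_odd_reflection[OF ij[symmetric]]
    by (auto simp: Nats_diff_1_iff coroot_sym[of j i] f_pair_sym[of j i])
qed

section \<open>Reflecting local nilpotency to all real roots\<close>

text \<open>The Leibniz rule for \<open>ad b\<close>, cut off after the second order since (ad b)^3
  kills b'. Here \<open>x\<close> is [b, b'] and \<open>c\<close> times \<open>b''\<close> is
  [b, x]; the last coefficient is \<open>c\<close> times a binomial, and the shift by 2 avoids
  subtraction of naturals.\<close>

lemma pow_commutator:
  assumes yx: "\<And>v. rho b (rho b' v) = rho b' (rho b v) + x v"
    and xz: "\<And>v. rho b (x v) = x (rho b v) + scale c (rho b'' v)"
    and zz: "\<And>v. rho b (rho b'' v) = rho b'' (rho b v)"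
  shows "(rho b ^^ (j + 2)) (rho b' v) = rho b' ((rho b ^^ (j + 2)) v)
    + scale (of_nat (j + 2)) (x ((rho b ^^ (j + 1)) v))
    + scale (c * of_nat (j + 2) * of_nat (j + 1) / 2) (rho b'' ((rho b ^^ j) v))"
proof (induction j)
  case 0
  have "x (rho b v) + x (rho b v) = scale 2 (x (rho b v))"
    using scale_left_distrib[of 1 1 "x (rho b v)"] by simp
  then show ?case by (simp add: yx xz numeral_2_eq_2 ac_simps)
next
  case (Suc j)
  have "(rho b ^^ (Suc j + 2)) (rho b' v) = rho b ((rho b ^^ (j + 2)) (rho b' v))" by simp
  also have "\<dots> = rho b' ((rho b ^^ (Suc j + 2)) v)
      + (scale 1 (x ((rho b ^^ (Suc j + 1)) v)) + scale (of_nat (j + 2)) (x ((rho b ^^ (Suc j + 1)) v)))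
      + (scale (of_nat (j + 2) * c) (rho b'' ((rho b ^^ Suc j) v))
        + scale (c * of_nat (j + 2) * of_nat (j + 1) / 2) (rho b'' ((rho b ^^ Suc j) v)))"
    unfolding Suc
    by (simp add: yx xz zz scale_right_distrib add.assoc del: of_nat_add of_nat_Suc)
  also have "\<dots> = rho b' ((rho b ^^ (Suc j + 2)) v)
      + scale (1 + of_nat (j + 2)) (x ((rho b ^^ (Suc j + 1)) v))
      + scale (of_nat (j + 2) * c + c * of_nat (j + 2) * of_nat (j + 1) / 2) (rho b'' ((rho b ^^ Suc j) v))"
    by (simp only: scale_left_distrib)
  also have "1 + of_nat (j + 2) = (of_nat (Suc j + 2) :: complex)" by simp
  also have "of_nat (j + 2) * c + c * of_nat (j + 2) * of_nat (j + 1) / 2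
      = c * of_nat (Suc j + 2) * of_nat (Suc j + 1) / 2"
    by (simp add: field_simps)
  finally show ?case .
qed

text \<open>On the kernel of \<open>b\<close>, the power \<open>b^(2N)\<close> carries \<open>b'^N\<close> to a nonzero multiple of
  \<open>((ad b)^2 b')^N\<close>; this replaces conjugation by \<open>exp b\<close>.\<close>

lemma pow_kernel:
  assumes yx: "\<And>v. rho b (rho b' v) = rho b' (rho b v) + x v"
    and xz: "\<And>v. rho b (x v) = x (rho b v) + scale c (rho b'' v)"
    and zz: "\<And>v. rho b (rho b'' v) = rho b'' (rho b v)"
    and x0: "x 0 = 0" and c: "c \<noteq> 0" and w: "rho b w = 0"
  shows "(\<exists>d. d \<noteq> 0 \<and> (rho b ^^ (2 * N)) ((rho b' ^^ N) w) = scale d ((rho b'' ^^ N) w))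
    \<and> (\<forall>j>2 * N. (rho b ^^ j) ((rho b' ^^ N) w) = 0)"
proof (induction N)
  case 0
  have "(rho b ^^ j) w = 0" if "j > 0" for j
    using rho_pow_zero[of 1 b w j] w that by simp
  then show ?case by (auto intro: exI[of _ 1])
next
  case (Suc N)
  let ?y = "(rho b' ^^ N) w"
  obtain d where d: "d \<noteq> 0" "(rho b ^^ (2 * N)) ?y = scale d ((rho b'' ^^ N) w)"
    and z: "\<And>j. j > 2 * N \<Longrightarrow> (rho b ^^ j) ?y = 0" using Suc by blast
  note pc = pow_commutator[OF yx xz zz, of _ ?y]
  \<comment> \<open>The powers 2N + 1 and 2N + 2 of \<open>b\<close> already kill \<open>?y\<close>,
    so only the second-order term of \<open>pow_commutator\<close> survives.\<close>
  let ?d = "c * of_nat (2 * N + 2) * of_nat (2 * N + 1) / 2 * d"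
  have "of_nat (2 * N + 2) \<noteq> (0::complex)" "of_nat (2 * N + 1) \<noteq> (0::complex)"
    unfolding of_nat_eq_0_iff by simp_all
  then have "?d \<noteq> 0" using c d by simp
  moreover have "(rho b ^^ (2 * Suc N)) ((rho b' ^^ Suc N) w) = scale ?d ((rho b'' ^^ Suc N) w)"
    using pc[of "2 * N"] by (simp add: z x0 d(2) del: of_nat_add of_nat_mult of_nat_Suc funpow.simps(2)) simp
  moreover have "(rho b ^^ j) ((rho b' ^^ Suc N) w) = 0" if "j > 2 * Suc N" for j
  proof -
    define i where "i = j - 2"
    have i: "j = i + 2" "i > 2 * N" using that by (auto simp: i_def)
    then show ?thesis using pc[of i] by (simp add: z x0 del: funpow.simps(2)) simp
  qed
  ultimately show ?case by blast
qed

lemma locnil_kernel: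
  assumes "locnil (rho b)"
  obtains w where "w \<noteq> 0" "rho b w = 0"
proof -
  define M where "M = (LEAST N. (rho b ^^ N) v0 = 0)"
  obtain N where N: "(rho b ^^ N) v0 = 0" using assms unfolding locnil_def by blast
  have M: "(rho b ^^ M) v0 = 0" unfolding M_def using N by (rule LeastI)
  have "M \<noteq> 0" using M v0_nonzero by (metis funpow_0)
  then obtain n where n: "M = Suc n" by (cases M) auto
  have "(rho b ^^ n) v0 \<noteq> 0" using not_less_Least[of n "\<lambda>N. (rho b ^^ N) v0 = 0"] n M_def by auto
  moreover have "rho b ((rho b ^^ n) v0) = 0" using M n by simp
  ultimately show thesis by (rule that)
qed

text \<open>If \<alpha> and \<beta> are the weights of \<open>Tt X m\<close> and
  \<open>Tt Y n\<close>, the new vector has weight \<beta> + 2\<alpha>, the reflection of \<beta> in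
  \<alpha>. Nilpotency of \<open>Tt Y n\<close> on one vector of the kernel of \<open>Tt X m\<close>
  transfers by \<open>pow_kernel\<close>; the condition on \<open>m\<close>, \<open>n\<close>
  removes the central term.\<close>

lemma locnil_reflect_root:
  assumes XY: "X = gE k \<and> Y = gF k \<or> X = gF k \<and> Y = gE k"
    and X: "locnil (rho (Tt X m))" and Y: "locnil (rho (Tt Y n))" and mn: "m + n \<noteq> 0 \<or> m = 0"
  shows "locnil (rho (Tt X (2 * m + n)))"
proof -
  \<comment> \<open>The sign tells the two orders of the sl(2)-triple apart; it cancels in the
    second commutator, which is -2 in both.\<close>
  define s :: complex where "s = (if X = gE k then 1 else -1)"
  have g: "gbr a X Y Z = (if Z = gH k then s else 0)"
    "gbr a X (gH k) Z = (if Z = X then - 2 * s else 0)" 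
    "gbr a X X Z = (if Z = X then 0 else 0)" for Z
    using XY by (auto simp: s_def dl_def)
  have o: "\<not> godd X" "\<not> godd Y" "gform a X (gH k) = 0" "gform a X X = 0" using XY by (auto simp: godd_def)
  obtain w where w: "w \<noteq> 0" "rho (Tt X m) w = 0" using locnil_kernel[OF X] .
  obtain N where N: "(rho (Tt Y n) ^^ N) w = 0" using Y unfolding locnil_def by blast
  have central: "of_int m * (if m + n = 0 then gform a X Y else 0) = 0" using mn by auto
  have 1: "rho (Tt X m) (rho (Tt Y n) v)
      = rho (Tt Y n) (rho (Tt X m) v) + scale s (rho (Tt (gH k) (m + n)) v)" for v
    unfolding comm1[OF g(1), of m n v] central by (simp add: o)
  have ss: "s * (- 2 * s) = - 2" by (simp add: s_def)
  have mmn: "m + (m + n) = 2 * m + n" by simp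
  have 2: "rho (Tt X m) (scale s (rho (Tt (gH k) (m + n)) v))
      = scale s (rho (Tt (gH k) (m + n)) (rho (Tt X m) v)) + scale (-2) (rho (Tt X (2 * m + n)) v)" for v
    unfolding rho_scale comm1[OF g(2), of m "m + n" v]
    by (simp only: o mmn simp_thms if_False if_cancel mult_zero_right scale_zero_left scale_one add_0_right
        scale_right_distrib scale_scale ss)
  have 3: "rho (Tt X m) (rho (Tt X (2 * m + n)) v) = rho (Tt X (2 * m + n)) (rho (Tt X m) v)" for v
    unfolding comm1[OF g(3), of m "2 * m + n" v] by (simp add: o)
  from pow_kernel[OF 1 2 3 _ _ w(2), of N]
  obtain d where "d \<noteq> 0" 
    "(rho (Tt X m) ^^ (2 * N)) ((rho (Tt Y n) ^^ N) w) = scale d ((rho (Tt X (2 * m + n)) ^^ N) w)"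
    by auto
  then have "(rho (Tt X (2 * m + n)) ^^ N) w = 0" using N by (simp add: rho_pow_lin)
  moreover have "X = gE k \<or> X = gF k" using XY by blast
  ultimately show ?thesis using locnil_rho_iff w(1) by blast
qed

text \<open>The hypotheses concern the negative simple roots of the affine sl(2) on
  \<open>k\<close>. Its two simple reflections, applied alternately, reach all negative real
  roots.\<close>

lemma locnil_real_roots:
  assumes F: "locnil (rho (Tt (gF k) 0))" and E: "locnil (rho (Tt (gE k) (-1)))"
  shows "locnil (rho (Tt (gF k) (- int r))) \<and> locnil (rho (Tt (gE k) (- int r - 1)))"
proof (induction r)
  case 0 then show ?case using F E by simp
next
  case (Suc r)
  have "locnil (rho (Tt (gF k) (2 * 0 + (- int r - 1))))"
    using Suc F by (intro locnil_reflect_root[where Y = "gE k" and k = k]) auto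
  moreover have "locnil (rho (Tt (gE k) (2 * (-1) + (- int r))))"
    using Suc E by (intro locnil_reflect_root[where Y = "gF k" and k = k]) auto
  moreover have "2 * 0 + (- int r - 1) = - int (Suc r)" "2 * (-1) + (- int r) = - int (Suc r) - 1" by simp_all
  ultimately show ?case by metis
qed

section \<open>From root spaces to root vectors\<close>

text \<open>The eigenvalue \<plusminus>2 of \<open>gH k\<close> already singles out
  \<open>X\<close>, since odd vectors have eigenvalues \<plusminus>1; so these root spaces are
  lines.\<close>

lemma awt_root_inj:
  assumes X: "X = gE k \<or> X = gF k" and eq: "awt X' n' = awt X n"
  shows "X' = X \<and> n' = n"
proof -
  have n: "n' = n" using fun_cong[OF eq, of hD] by (simp add: awt_def)
  have g: "gwt X' j = gwt X j" for j using fun_cong[OF eq, of "hH j"] by (simp add: awt_def)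
  have "X' = X"
    using X g[of k] by (cases X') (auto simp: gwt_def dl_def sg_def split: if_splits)
  then show ?thesis using n by simp
qed

lemma root_integrable_iff:
  assumes X: "X = gE k \<or> X = gF k" and g: "\<gamma> = (\<lambda>h. - awt X n h)"
  shows "root_integrable scale rho \<gamma> \<longleftrightarrow> locnil (rho (Tt X n))"
proof
  assume r: "root_integrable scale rho \<gamma>"
  have "locnil (\<lambda>w. sum_list (map (\<lambda>Z. scale (if Z = X then 1 else 0) (rho (Tt Z n) w)) gall))"
  proof (rule r[unfolded root_integrable_def, rule_format])
    fix Z assume "(if Z = X then 1 else 0 :: complex) \<noteq> 0"
    then have "Z = X" by (simp split: if_splits)
    then show "awt Z n = (\<lambda>h. - \<gamma> h)" by (simp add: g)
  qed
  moreover have "(\<lambda>Z. scale (if Z = X then 1 else 0) (rho (Tt Z n) w)) 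
      = (\<lambda>Z. if Z = X then rho (Tt Z n) w else 0)" for w by auto
  ultimately show "locnil (rho (Tt X n))" by (simp add: sum_list_gall_delta)
next
  assume l: "locnil (rho (Tt X n))"
  show "root_integrable scale rho \<gamma>"
    unfolding root_integrable_def
  proof (intro allI impI)
    fix n' cf assume cf: "\<forall>Z. cf Z \<noteq> (0::complex) \<longrightarrow> awt Z n' = (\<lambda>h. - \<gamma> h)"
    then have c0: "cf Z = 0" if "Z \<noteq> X \<or> n' \<noteq> n" for Z
      using awt_root_inj[OF X, of Z n' n] that unfolding g by auto
    \<comment> \<open>For n' \<noteq> n every coefficient is zero, \<open>cf X\<close> included, and
      both sides are the zero map.\<close>
    have "(\<lambda>Z. scale (cf Z) (rho (Tt Z n') w))
        = (\<lambda>Z. if Z = X then scale (cf X) (rho (Tt X n) w) else 0)" for w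
      using c0 by (cases "n' = n") (auto simp: fun_eq_iff)
    then have eq: "(\<lambda>w. sum_list (map (\<lambda>Z. scale (cf Z) (rho (Tt Z n') w)) gall))
        = (\<lambda>w. scale (cf X) (rho (Tt X n) w))"
      by (simp add: sum_list_gall_delta)
    have pow: "((\<lambda>w. scale (cf X) (rho (Tt X n) w)) ^^ N) w = scale (cf X ^ N) ((rho (Tt X n) ^^ N) w)" for N w
      by (induction N) (simp_all add: mult.commute)
    show "locnil (\<lambda>w. sum_list (map (\<lambda>Z. scale (cf Z) (rho (Tt Z n') w)) gall))"
      unfolding eq locnil_def pow using l unfolding locnil_def by (metis scale_zero_right)
  qed
qed

lemma sharp_roots:
  "(\<lambda>h. wadd (alpha 1) (alpha 2) h + of_nat r * deltaw h) = (\<lambda>h. - awt (gF I3) (- int r) h)"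
  "(\<lambda>h. wadd (alpha 1) (alpha 3) h + of_nat r * deltaw h) = (\<lambda>h. - awt (gF I2) (- int r) h)"
  "(\<lambda>h. - wadd (alpha 1) (alpha 2) h + of_nat r * deltaw h) = (\<lambda>h. - awt (gE I3) (- int r) h)"
  "(\<lambda>h. - wadd (alpha 1) (alpha 3) h + of_nat r * deltaw h) = (\<lambda>h. - awt (gE I2) (- int r) h)"
  by (auto simp: fun_eq_iff wadd_def alpha_def epsw_def deltaw_def awt_def gwt_def dl_def split: hhat.split)

lemma positive_sharp_roots:
  "wadd (alpha 1) (alpha 2) = (\<lambda>h. - awt (gF I3) 0 h)"
  "wadd (alpha 1) (alpha 3) = (\<lambda>h. - awt (gF I2) 0 h)"
  using sharp_roots(1,2)[of 0] by simp_all

lemma other_roots: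
  "wadd (alpha 0) (alpha 1) = (\<lambda>h. - awt (gE I1) (-1) h)"
  "wadd (alpha 2) (alpha 3) = (\<lambda>h. - awt (gF I1) 0 h)"
  by (auto simp: fun_eq_iff wadd_def alpha_def epsw_def deltaw_def awt_def gwt_def dl_def split: hhat.split)

text \<open>The four pairs give the simple roots of two affine sl(2)'s: \<alpha>_1 + \<alpha>_2,
  \<alpha>_0 + \<alpha>_3 on \<open>I3\<close> and \<alpha>_1 + \<alpha>_3, \<alpha>_0 + \<alpha>_2
  on \<open>I2\<close>. All other conditions follow by reflections.\<close>

lemma integrable_iff:
  "integrable scale rho \<longleftrightarrow> locnil (rho (f_pair N1 N2)) \<and> locnil (rho (f_pair N1 N3))
    \<and> locnil (rho (f_pair N0 N3)) \<and> locnil (rho (f_pair N0 N2))"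
proof -
  have F: "root_integrable scale rho (\<lambda>h. - awt (gF k) n h) \<longleftrightarrow> locnil (rho (Tt (gF k) n))"
    and E: "root_integrable scale rho (\<lambda>h. - awt (gE k) n h) \<longleftrightarrow> locnil (rho (Tt (gE k) n))" for k n
    using root_integrable_iff by blast+
  have "integrable scale rho \<longleftrightarrow> locnil (rho (Tt (gF I3) 0)) \<and> locnil (rho (Tt (gF I2) 0))
    \<and> (\<forall>r::nat. r > 0 \<longrightarrow> locnil (rho (Tt (gF I3) (- int r)))) \<and> (\<forall>r::nat. r > 0 \<longrightarrow> locnil (rho (Tt (gF I2) (- int r))))
    \<and> (\<forall>r::nat. r > 0 \<longrightarrow> locnil (rho (Tt (gE I3) (- int r)))) \<and> (\<forall>r::nat. r > 0 \<longrightarrow> locnil (rho (Tt (gE I2) (- int r))))"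
    unfolding integrable_def posrootsharp_def rootsharp_def ball_simps sharp_roots
    by (simp only: positive_sharp_roots F E simp_thms conj_assoc)
  also have "\<dots> \<longleftrightarrow> locnil (rho (Tt (gF I3) 0)) \<and> locnil (rho (Tt (gF I2) 0))
    \<and> locnil (rho (Tt (gE I3) (-1))) \<and> locnil (rho (Tt (gE I2) (-1)))"
  proof (intro iffI; elim conjE; intro conjI allI impI)
    fix r :: nat assume l: "locnil (rho (Tt (gF I3) 0))" "locnil (rho (Tt (gE I3) (-1)))" and "r > 0"
    then obtain q where "r = Suc q" by (cases r) auto
    then have "- int q - 1 = - int r" by simp
    then show "locnil (rho (Tt (gF I3) (- int r)))" "locnil (rho (Tt (gE I3) (- int r)))"
      using locnil_real_roots[OF l, of r] locnil_real_roots[OF l, of q] by metis+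
  next
    fix r :: nat assume l: "locnil (rho (Tt (gF I2) 0))" "locnil (rho (Tt (gE I2) (-1)))" and "r > 0"
    then obtain q where "r = Suc q" by (cases r) auto
    then have "- int q - 1 = - int r" by simp
    then show "locnil (rho (Tt (gF I2) (- int r)))" "locnil (rho (Tt (gE I2) (- int r)))"
      using locnil_real_roots[OF l, of r] locnil_real_roots[OF l, of q] by metis+
  next
    assume "\<forall>r::nat. r > 0 \<longrightarrow> locnil (rho (Tt (gE I3) (- int r)))"
    from this[rule_format, of 1] show "locnil (rho (Tt (gE I3) (-1)))" by simp
  next
    assume "\<forall>r::nat. r > 0 \<longrightarrow> locnil (rho (Tt (gE I2) (- int r)))"
    from this[rule_format, of 1] show "locnil (rho (Tt (gE I2) (-1)))" by simp
  qed
  finally show ?thesis by (auto simp: f_pair_def)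
qed

end

theorem theorem6p3:
  fixes a :: real
    and scale :: "complex \<Rightarrow> 'v::ab_group_add \<Rightarrow> 'v"
    and rho :: "abasis \<Rightarrow> 'v \<Rightarrow> 'v"
    and Lam :: "hhat \<Rightarrow> complex"
    and v0 :: 'v
    and m :: "nat \<Rightarrow> complex"
  assumes ha: "a \<in> \<rat>" "-1 < a" "a < 0"
    and hL: "is_L a scale rho Lam v0"
    and hm: "\<And>i. m i = hform a Lam (alpha i)"
    and hk: "(\<Sum>i\<le>3. m i) \<noteq> 0"
  shows "(integrable scale rho \<longleftrightarrow>
            ((m 1 + m 2) / of_real a \<in> \<nat> \<and> (m 0 + m 3) / of_real a \<in> \<nat>
             \<and> - (m 1 + m 3) / (of_real a + 1) \<in> \<nat> \<and> - (m 0 + m 2) / (of_real a + 1) \<in> \<nat>)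
            \<and> (\<forall>i\<in>{0,1}. \<forall>j\<in>{2,3}. m i + m j = 0 \<longrightarrow> m i = 0 \<and> m j = 0))
       \<and> (root_integrable scale rho (wadd (alpha 0) (alpha 1)) \<longleftrightarrow>
            m 0 + m 1 \<in> \<nat> \<and> (m 0 + m 1 = 0 \<longrightarrow> m 0 = 0 \<and> m 1 = 0))
       \<and> (root_integrable scale rho (wadd (alpha 2) (alpha 3)) \<longleftrightarrow>
            m 2 + m 3 \<in> \<nat> \<and> (m 2 + m 3 = 0 \<longrightarrow> m 2 = 0 \<and> m 3 = 0))"
proof -
  have "Vector_Spaces.vector_space scale" by (insert hL, unfold is_L_def, elim conjE, assumption)
  then interpret L_module scale a rho Lam v0
    using hL ha by (simp add: L_module_def L_module_axioms_def)
  have m: "m 0 = hform a Lam (alpha (node_no N0))" "m 1 = hform a Lam (alpha (node_no N1))"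
    "m 2 = hform a Lam (alpha (node_no N2))" "m 3 = hform a Lam (alpha (node_no N3))" by (simp_all add: hm)
  have b1: "x / (2 * bco a I1) = x" and b3: "x / (2 * bco a I3) = x / of_real a"
    and b2: "x / (2 * bco a I2) = - x / (of_real a + 1)" for x
  proof -
    have "2 * bco a I2 = - (of_real a + 1)" by (simp add: bco_def)
    then show "x / (2 * bco a I2) = - x / (of_real a + 1)"
      by (simp only: minus_divide_left[symmetric] minus_divide_right[symmetric])
  qed (simp_all add: bco_def)
  \<comment> \<open>As \<open>bco\<close> is nonzero, the coroot value vanishes exactly when the sum
    of the two labels does.\<close>
  have p: "locnil (rho (f_pair i j)) \<longleftrightarrow> (hform a Lam (alpha (node_no i)) + hform a Lam (alpha (node_no j))) / (2 * bco a (pair_idx i j)) \<in> \<nat>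
     \<and> (hform a Lam (alpha (node_no i)) + hform a Lam (alpha (node_no j)) = 0
        \<longrightarrow> hform a Lam (alpha (node_no i)) = 0 \<and> hform a Lam (alpha (node_no j)) = 0)" if "i \<noteq> j" for i j
    using locnil_f_pair_iff[OF that] bco_nonzero[of "pair_idx i j"] unfolding coroot_hform[OF that] by auto
  have p12: "locnil (rho (f_pair N1 N2)) \<longleftrightarrow> (m 1 + m 2) / of_real a \<in> \<nat> \<and> (m 1 + m 2 = 0 \<longrightarrow> m 1 = 0 \<and> m 2 = 0)"
    using p[of N1 N2] unfolding m pair_idx.simps b1 b2 b3 by simp
  have p03: "locnil (rho (f_pair N0 N3)) \<longleftrightarrow> (m 0 + m 3) / of_real a \<in> \<nat> \<and> (m 0 + m 3 = 0 \<longrightarrow> m 0 = 0 \<and> m 3 = 0)"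
    using p[of N0 N3] unfolding m pair_idx.simps b1 b2 b3 by simp
  have p13: "locnil (rho (f_pair N1 N3)) \<longleftrightarrow> - (m 1 + m 3) / (of_real a + 1) \<in> \<nat> \<and> (m 1 + m 3 = 0 \<longrightarrow> m 1 = 0 \<and> m 3 = 0)"
    using p[of N1 N3] unfolding m pair_idx.simps b1 b2 b3 by simp
  have p02: "locnil (rho (f_pair N0 N2)) \<longleftrightarrow> - (m 0 + m 2) / (of_real a + 1) \<in> \<nat> \<and> (m 0 + m 2 = 0 \<longrightarrow> m 0 = 0 \<and> m 2 = 0)"
    using p[of N0 N2] unfolding m pair_idx.simps b1 b2 b3 by simp
  have "root_integrable scale rho (wadd (alpha 0) (alpha 1)) \<longleftrightarrow> locnil (rho (f_pair N0 N1))"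
    using root_integrable_iff[OF disjI1[OF refl] other_roots(1)] by (simp add: f_pair_def)
  then have r01: "root_integrable scale rho (wadd (alpha 0) (alpha 1)) \<longleftrightarrow>
      m 0 + m 1 \<in> \<nat> \<and> (m 0 + m 1 = 0 \<longrightarrow> m 0 = 0 \<and> m 1 = 0)"
    using p[of N0 N1] unfolding m pair_idx.simps b1 b2 b3 by simp
  have "root_integrable scale rho (wadd (alpha 2) (alpha 3)) \<longleftrightarrow> locnil (rho (f_pair N2 N3))"
    using root_integrable_iff[OF disjI2[OF refl] other_roots(2)] by (simp add: f_pair_def)
  then have r23: "root_integrable scale rho (wadd (alpha 2) (alpha 3)) \<longleftrightarrow>
      m 2 + m 3 \<in> \<nat> \<and> (m 2 + m 3 = 0 \<longrightarrow> m 2 = 0 \<and> m 3 = 0)"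
    using p[of N2 N3] unfolding m pair_idx.simps b1 b2 b3 by simp
  have "integrable scale rho \<longleftrightarrow>
            ((m 1 + m 2) / of_real a \<in> \<nat> \<and> (m 0 + m 3) / of_real a \<in> \<nat>
             \<and> - (m 1 + m 3) / (of_real a + 1) \<in> \<nat> \<and> - (m 0 + m 2) / (of_real a + 1) \<in> \<nat>)
            \<and> (\<forall>i\<in>{0,1}. \<forall>j\<in>{2,3}. m i + m j = 0 \<longrightarrow> m i = 0 \<and> m j = 0)"
    unfolding integrable_iff p12 p03 p13 p02 by blast
  then show ?thesis using r01 r23 by blast
qed

end
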